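(* Let $P\subseteq\mathbb{R}^d$ be a rational $d$-polytope with codenominator $r$, and let $m\in\mathbb{Z}_{>0}$ be such that $\frac{m}{r}P$ is a lattice polytope. Then $$\operatorname{Ehr}_{\mathbb{Q}}(P;t)=\frac{\operatorname{h}^*_{\mathbb{Q}}(P;t;m)}{\left(1-t^{\frac{m}{r}}\right)^{d+1}},$$ where $\operatorname{h}^*_{\mathbb{Q}}(P;t;m)$ is a polynomial in $\mathbb{Z}[t^{\frac1r}]$ with nonnegative integral coefficients. Consequently, the rational Ehrhart counting function $\operatorname{ehr}_{\mathbb{Q}}(P;\lambda)$ (for rational $\lambda\ge 0$) is a quasipolynomial in $\lambda$, and the period of $\operatorname{ehr}_{\mathbb{Q}}(P;\lambda)$ divides $\frac{m}{r}$, i.e., this period is of the form $\frac{j}{r}$ with $j\mid m$.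
   Context: A rational (resp. lattice) polytope is the convex hull of finitely many points of $\mathbb{Q}^d$ (resp. $\mathbb{Z}^d$); a $d$-polytope is a $d$-dimensional polytope in $\mathbb{R}^d$, $d\ge1$. Codenominator: write a rational $d$-polytope $P$ by its irredundant halfspace description $P=\{\mathbf{x}\in\mathbb{R}^d:\mathbf{A}\mathbf{x}\le\mathbf{b}\}$ with $\mathbf{A}\in\mathbb{Z}^{n\times d}$, $\mathbf{b}\in\mathbb{Z}^n$, such that for every $i$ the greatest common divisor of $b_i$ and the entries of the $i$th row of $\mathbf{A}$ is $1$; the codenominator of $P$ is the (positive) least common multiple $r$ of the nonzero entries of $\mathbf{b}$. The rational Ehrhart counting function is $\operatorname{ehr}_{\mathbb{Q}}(P;\lambda)=|\lambda P\cap\mathbb{Z}^d|$ for rational $\lambda\ge0$. The rational Ehrhart series is $\operatorname{Ehr}_{\mathbb{Q}}(P;t)=1+\sum_{n\in\mathbb{Z}_{>0}}\operatorname{ehr}_{\mathbb{Q}}(P;\frac nr)\,t^{\frac nr}$, a formal power series in $t^{1/r}$. A function of a rational variable $\lambda$ is a quasipolynomial if it has the form $c_d(\lambda)\lambda^d+\dots+c_1(\lambda)\lambda+c_0(\lambda)$ with periodic functions $c_0,\dots,c_d:\mathbb{Q}\to\mathbb{Q}$; its period is the least common period of $c_0(\lambda),\dots,c_d(\lambda)$. *)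

theory Defs
  imports "HOL-Analysis.Analysis" "HOL-Computational_Algebra.Polynomial_FPS"
begin

definition rational_points :: "(real ^ 'd) set" where
  "rational_points = {x. \<forall>i. x $ i \<in> \<rat>}"

definition integer_points :: "(real ^ 'd) set" where
  "integer_points = {x. \<forall>i. x $ i \<in> \<int>}"

definition rational_polytope :: "(real ^ 'd) set \<Rightarrow> bool" where
  "rational_polytope P \<longleftrightarrow> (\<exists>V. finite V \<and> V \<subseteq> rational_points \<and> P = convex hull V)"

definition lattice_polytope :: "(real ^ 'd) set \<Rightarrow> bool" where
  "lattice_polytope P \<longleftrightarrow> (\<exists>V. finite V \<and> V \<subseteq> integer_points \<and> P = convex hull V)"

definition dilate :: "real \<Rightarrow> (real ^ 'd) set \<Rightarrow> (real ^ 'd) set" where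
  "dilate c P = (\<lambda>x. c *\<^sub>R x) ` P"

text \<open>The row vectors \<open>A i\<close> and right-hand sides \<open>b i\<close> are relevant for \<open>i \<in> I\<close> only.\<close>

definition halfspace_intersection ::
    "(nat \<Rightarrow> int ^ 'd) \<Rightarrow> (nat \<Rightarrow> int) \<Rightarrow> nat set \<Rightarrow> (real ^ 'd) set" where
  "halfspace_intersection A b I =
     {x. \<forall>i\<in>I. (\<Sum>k\<in>UNIV. real_of_int (A i $ k) * x $ k) \<le> real_of_int (b i)}"

definition irredundant_description ::
    "(real ^ 'd) set \<Rightarrow> nat \<Rightarrow> (nat \<Rightarrow> int ^ 'd) \<Rightarrow> (nat \<Rightarrow> int) \<Rightarrow> bool" where
  "irredundant_description P n A b \<longleftrightarrow>
     P = halfspace_intersection A b {..<n} \<and>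
     (\<forall>i<n. halfspace_intersection A b ({..<n} - {i}) \<noteq> P) \<and>
     (\<forall>i<n. Gcd (insert (b i) (range (\<lambda>k. A i $ k))) = 1)"

text \<open>
  A relation rather than a function. For a full-dimensional rational polytope the description is
  unique up to the order of its rows, so the codenominator exists and is unique.
  \<open>Lcm\<close> on \<open>int\<close> is nonnegative, and positive for a finite set without \<open>0\<close>.
\<close>

definition is_codenominator :: "(real ^ 'd) set \<Rightarrow> nat \<Rightarrow> bool" where
  "is_codenominator P r \<longleftrightarrow>
     (\<exists>n A b. irredundant_description P n A b \<and> int r = Lcm {b i | i. i < n \<and> b i \<noteq> 0})"

definition ehr :: "(real ^ 'd) set \<Rightarrow> rat \<Rightarrow> nat" where
  "ehr P l = card (dilate (real_of_rat l) P \<inter> integer_points)"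

text \<open>The formal variable stands for \<open>t\<close> to the power \<open>1/r\<close>.\<close>

definition ehrhart_series :: "(real ^ 'd) set \<Rightarrow> nat \<Rightarrow> rat fps" where
  "ehrhart_series P r =
     Abs_fps (\<lambda>n. if n = 0 then 1 else of_nat (ehr P (of_nat n / of_nat r)))"

definition is_period :: "rat \<Rightarrow> (rat \<Rightarrow> rat) \<Rightarrow> bool" where
  "is_period p c \<longleftrightarrow> p > 0 \<and> (\<forall>x. c (x + p) = c x)"

text \<open>
  The coefficient functions live on all of \<open>rat\<close>; the represented function matters on
  nonnegative arguments only.
\<close>

definition quasipolynomial_coeffs :: "nat \<Rightarrow> (nat \<Rightarrow> rat \<Rightarrow> rat) \<Rightarrow> (rat \<Rightarrow> rat) \<Rightarrow> bool" where
  "quasipolynomial_coeffs d c f \<longleftrightarrow>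
     (\<forall>i\<le>d. \<exists>p. is_period p (c i)) \<and> (\<forall>l\<ge>0. f l = (\<Sum>i\<le>d. c i l * l ^ i))"

definition quasipolynomial :: "nat \<Rightarrow> (rat \<Rightarrow> rat) \<Rightarrow> bool" where
  "quasipolynomial d f \<longleftrightarrow> (\<exists>c. quasipolynomial_coeffs d c f)"

definition least_common_period :: "nat \<Rightarrow> (nat \<Rightarrow> rat \<Rightarrow> rat) \<Rightarrow> rat \<Rightarrow> bool" where
  "least_common_period d c p \<longleftrightarrow>
     (\<forall>i\<le>d. is_period p (c i)) \<and> (\<forall>q. (\<forall>i\<le>d. is_period q (c i)) \<longrightarrow> p \<le> q)"

end

theory Submission imports Defs begin

text \<open>
  The idea is to replace \<open>P\<close> by the lattice polytope \<open>Q = (m/r) P\<close>: the \<open>l\<close>-th dilate of \<open>P\<close> is the dilate of \<open>Q\<close> by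
  \<open>s = l r/m\<close>, so everything is about counting lattice points in dilates of a lattice polytope by
  rational factors. All dilates of \<open>Q\<close> together form the cone over \<open>Q \<times> {1}\<close>, with \<open>s\<close> as the height.
  
  This cone is a disjoint union of half-open simplicial cones spanned by lifted vertices
  (\<open>half_open_decomposition\<close>): a regular triangulation, given by generic weights on the vertices, cuts it
  into simplicial cones, and a generic interior direction decides to which of the adjacent cones a
  common face belongs. In one half-open cone every point is, in a unique way, a point of the
  half-open fundamental parallelepiped plus a nonnegative integer combination of the \<open>d + 1\<close>
  generators. The generators are lattice points of height \<open>1\<close>, so this does not change the
  lattice condition and changes the height by an integer. Hence, along any progression of heights
  with step \<open>1/m\<close>, the counting series times \<open>(1 - X^m)^(d+1)\<close> is the series that counts points of the
  parallelepipeds; it has nonnegative coefficients and vanishes from height \<open>d + 1\<close> on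
  (\<open>count_series_lattice_polytope\<close>). Step \<open>1/m\<close> and offset \<open>0\<close> give the numerator polynomial. Step \<open>1\<close> and an
  arbitrary offset in \<open>[0, 1)\<close> express the count on each residue class of heights modulo \<open>1\<close> by
  binomial coefficients, which is the quasipolynomial with period \<open>m/r\<close> (\<open>quasipolynomial_of_series\<close>).
  
  The coefficient functions of a quasipolynomial are determined by its values
  (\<open>quasipolynomial_coeffs_unique\<close>), so \<open>m/r\<close> is a period of every choice of coefficients. That no period
  escapes the grid of multiples of \<open>1/r\<close> is due to the codenominator: all right-hand sides \<open>b\<close> of the
  facet inequalities divide \<open>r\<close> or are \<open>0\<close>, so the counting function is constant between consecutive
  multiples of \<open>1/r\<close> (\<open>ehr_constant_between\<close>). A common period off the grid would force it to be
  constant altogether (\<open>common_period_multiple\<close>), but it grows from \<open>1\<close> at \<open>0\<close> to at least \<open>2\<close> at \<open>m/r\<close>. So the common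
  periods are the multiples of some \<open>j/r\<close>, and \<open>j\<close> divides \<open>m\<close>.
\<close>

section \<open>Cones over finite sets and their bases\<close>
definition nonneg_cone :: "'a::real_vector set \<Rightarrow> 'a set" where
  "nonneg_cone V = {x. \<exists>c. (\<forall>v\<in>V. 0 \<le> c v) \<and> x = (\<Sum>v\<in>V. c v *\<^sub>R v)}"

definition bases_within :: "'a::real_vector set \<Rightarrow> 'a set set" where
  "bases_within V = {B. B \<subseteq> V \<and> independent B \<and> span B = UNIV}"

text \<open>
  One weight at a time: a new weight only has to avoid, for each \<open>g\<close> with a nonzero value at the new point,
  the single number that makes the sum vanish.
\<close>
lemma generic_weights:
  fixes G :: "('a \<Rightarrow> real) set"
  assumes "finite V" "finite G" "\<And>g. g \<in> G \<Longrightarrow> \<exists>v\<in>V. g v \<noteq> 0"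
  shows "\<exists>a. (\<forall>v\<in>V. 0 < a v) \<and> (\<forall>g\<in>G. (\<Sum>v\<in>V. g v * a v) \<noteq> 0)"
  using assms
proof (induction V arbitrary: G rule: finite_induct)
  case empty
  then show ?case by auto
next
  case (insert x V)
  define G' where "G' = {g \<in> G. \<exists>v\<in>V. g v \<noteq> 0}"
  have "finite G'" "\<And>g. g \<in> G' \<Longrightarrow> \<exists>v\<in>V. g v \<noteq> 0"
    using insert.prems by (auto simp: G'_def)
  from insert.IH[OF this] obtain a
    where a: "\<forall>v\<in>V. 0 < a v" "\<forall>g\<in>G'. (\<Sum>v\<in>V. g v * a v) \<noteq> 0" by blast
  define bad where "bad = (\<lambda>g. - (\<Sum>v\<in>V. g v * a v) / g x) ` G"
  have "infinite ({0<..} - bad)"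
    using insert.prems(1) infinite_Ioi[of "0::real"] by (auto simp: bad_def)
  then obtain t where t: "t > 0" "t \<notin> bad"
    by (metis Diff_iff finite.emptyI greaterThan_iff ex_in_conv)
  define a' where "a' = a(x := t)"
  have eq: "(\<Sum>v\<in>insert x V. g v * a' v) = g x * t + (\<Sum>v\<in>V. g v * a v)" for g
  proof -
    have "(\<Sum>v\<in>V. g v * a' v) = (\<Sum>v\<in>V. g v * a v)"
      using insert.hyps by (intro sum.cong) (auto simp: a'_def)
    then show ?thesis using insert.hyps by (simp add: a'_def)
  qed
  have "(\<Sum>v\<in>insert x V. g v * a' v) \<noteq> 0" if g: "g \<in> G" for g
  proof (cases "g x = 0")
    case True
    then have "g \<in> G'" using insert.prems(2)[OF g] g by (auto simp: G'_def)
    then show ?thesis using a(2) True by (simp add: eq)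
  next
    case False
    have "t \<noteq> - (\<Sum>v\<in>V. g v * a v) / g x" using t g by (auto simp: bad_def)
    then have "g x * t \<noteq> - (\<Sum>v\<in>V. g v * a v)" using False by (auto simp: field_simps)
    then show ?thesis unfolding eq by linarith
  qed
  moreover have "\<forall>v\<in>insert x V. 0 < a' v" using a t by (auto simp: a'_def)
  ultimately show ?case by blast
qed

text \<open>
  The reduction step of the conic Caratheodory theorem, done so that a linear cost never grows. A
  linear relation among the points used may be oriented so that moving along it does not increase
  the cost; since all points have height \<open>1\<close>, its coefficients sum to \<open>0\<close>, so some coefficient decreases and
  moving far enough makes a point drop out.
\<close>
lemma reduce_to_independent_support:
  fixes V :: "'a::real_vector set" and ht :: "'a \<Rightarrow> real"
  assumes V: "finite V" "linear ht" "\<And>v. v \<in> V \<Longrightarrow> ht v = 1"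
    and c: "\<And>v. v \<in> V \<Longrightarrow> 0 \<le> c v"
  shows "\<exists>c'. (\<forall>v\<in>V. 0 \<le> c' v) \<and> (\<Sum>v\<in>V. c' v *\<^sub>R v) = (\<Sum>v\<in>V. c v *\<^sub>R v) \<and>
    (\<Sum>v\<in>V. c' v * a v) \<le> (\<Sum>v\<in>V. c v * a v) \<and> independent {v \<in> V. c' v \<noteq> 0}"
  using c
proof (induction "card {v \<in> V. c v \<noteq> 0}" arbitrary: c rule: less_induct)
  case less
  define S where "S = {v \<in> V. c v \<noteq> 0}"
  have S: "finite S" "S \<subseteq> V" using V(1) by (auto simp: S_def)
  show ?case
  proof (cases "independent S")
    case True
    then show ?thesis using less.prems by (intro exI[of _ c]) (auto simp: S_def)
  next
    case False
    then obtain u0 where u0: "\<exists>v\<in>S. u0 v \<noteq> 0" "(\<Sum>v\<in>S. u0 v *\<^sub>R v) = 0"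
      using S by (auto simp: dependent_finite)
    define u where "u = (if (\<Sum>v\<in>S. u0 v * a v) \<ge> 0 then u0 else (\<lambda>v. - u0 v))"
    have u: "\<exists>v\<in>S. u v \<noteq> 0" "(\<Sum>v\<in>S. u v *\<^sub>R v) = 0" "(\<Sum>v\<in>S. u v * a v) \<ge> 0"
      using u0 by (auto simp: u_def sum_negf)
    have "(\<Sum>v\<in>S. u v) = (\<Sum>v\<in>S. u v * ht v)"
      using S V(3) by (intro sum.cong) auto
    also have "\<dots> = ht (\<Sum>v\<in>S. u v *\<^sub>R v)"
      using V(2) by (simp add: linear_sum linear_scale)
    also have "\<dots> = 0" using u(2) V(2) by (simp add: linear_0)
    finally have sum0: "(\<Sum>v\<in>S. u v) = 0" .
    define U where "U = {v\<in>S. u v > 0}"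
    have "U \<noteq> {}"
    proof
      assume "U = {}"
      then have "\<forall>v\<in>S. 0 \<le> - u v" by (auto simp: U_def not_less)
      moreover have "(\<Sum>v\<in>S. - u v) = 0" using sum0 by (simp add: sum_negf)
      ultimately have "\<forall>v\<in>S. u v = 0"
        using sum_nonneg_eq_0_iff[OF S(1), of "\<lambda>v. - u v"] by auto
      then show False using u(1) by auto
    qed
    have "finite U" using S by (auto simp: U_def)
    \<comment> \<open>The largest step that keeps all coefficients nonnegative.\<close>
    define \<theta> where "\<theta> = Min ((\<lambda>v. c v / u v) ` U)"
    have "\<theta> \<in> (\<lambda>v. c v / u v) ` U"
      unfolding \<theta>_def using \<open>finite U\<close> \<open>U \<noteq> {}\<close> by (intro Min_in) auto
    then obtain v0 where v0: "v0 \<in> U" "\<theta> = c v0 / u v0" by auto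
    have le: "\<theta> \<le> c v / u v" if "v \<in> U" for v
      unfolding \<theta>_def using \<open>finite U\<close> that by (intro Min_le) auto
    have \<theta>0: "\<theta> \<ge> 0" using v0 less.prems S by (auto simp: U_def)
    define d where "d = (\<lambda>v. if v \<in> S then c v - \<theta> * u v else 0)"
    have d_nonneg: "0 \<le> d v" if "v \<in> V" for v
    proof (cases "v \<in> S")
      case vS: True
      show ?thesis
      proof (cases "u v > 0")
        case True
        then have "\<theta> \<le> c v / u v" using vS by (intro le) (auto simp: U_def)
        then show ?thesis using True vS by (simp add: d_def pos_le_divide_eq)
      next
        case False
        then have "\<theta> * u v \<le> 0" using \<theta>0 by (simp add: mult_nonneg_nonpos)
        then show ?thesis using less.prems[OF that] vS by (simp add: d_def)
      qed
    qed (auto simp: d_def)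
    have supp: "{v\<in>V. d v \<noteq> 0} \<subset> S"
    proof
      show "{v\<in>V. d v \<noteq> 0} \<subseteq> S" by (auto simp: d_def split: if_splits)
      have "v0 \<in> S" "d v0 = 0" using v0 by (auto simp: U_def d_def)
      then show "{v\<in>V. d v \<noteq> 0} \<noteq> S" by auto
    qed
    have c_S: "(\<Sum>v\<in>V. c v *\<^sub>R v) = (\<Sum>v\<in>S. c v *\<^sub>R v)"
      "(\<Sum>v\<in>V. c v * a v) = (\<Sum>v\<in>S. c v * a v)"
      using V(1) S by (auto intro!: sum.mono_neutral_right simp: S_def)
    have d_S: "(\<Sum>v\<in>V. d v *\<^sub>R v) = (\<Sum>v\<in>S. (c v - \<theta> * u v) *\<^sub>R v)"
      "(\<Sum>v\<in>V. d v * a v) = (\<Sum>v\<in>S. (c v - \<theta> * u v) * a v)"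
      using V(1) S by (auto intro!: sum.mono_neutral_cong_right simp: d_def)
    have same: "(\<Sum>v\<in>V. d v *\<^sub>R v) = (\<Sum>v\<in>V. c v *\<^sub>R v)"
      using u(2) unfolding c_S d_S
      by (simp add: scaleR_left_diff_distrib sum_subtractf flip: scaleR_scaleR scaleR_sum_right)
    have cost: "(\<Sum>v\<in>V. d v * a v) \<le> (\<Sum>v\<in>V. c v * a v)"
      using u(3) \<theta>0 unfolding c_S d_S
      by (simp add: left_diff_distrib sum_subtractf mult.assoc flip: sum_distrib_left)
    have "card {v\<in>V. d v \<noteq> 0} < card {v\<in>V. c v \<noteq> 0}"
      using psubset_card_mono[OF S(1) supp] by (simp add: S_def)
    from less.hyps[OF this d_nonneg] show ?thesis using same cost by (auto intro: order_trans)
  qed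
qed

text \<open>
  Relative to a basis taken from \<open>V\<close>, the functions \<open>representation B _ b\<close> are the linear coordinates; they take
  the place of the facet inequalities of the simplicial cone spanned by \<open>B\<close>.
\<close>
context
  fixes V B :: "'a::euclidean_space set"
  assumes B: "B \<in> bases_within V"
begin

lemma basis_facts: "independent B" "finite B" "B \<subseteq> V" "x \<in> span B" "card B = DIM('a)"
proof -
  show ind: "independent B" and "B \<subseteq> V" and "x \<in> span B"
    using B by (auto simp: bases_within_def)
  show "finite B" using ind by (rule independent_imp_finite)
  show "card B = DIM('a)"
    using B basis_card_eq_dim[of B UNIV] by (auto simp: bases_within_def)
qed

lemma coord_expansion: "(\<Sum>b\<in>B. representation B x b *\<^sub>R b) = x"
  by (rule real_vector.sum_representation_eq) (use basis_facts in auto)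

lemma coord_add: "representation B (x + y) b = representation B x b + representation B y b"
  by (simp add: real_vector.representation_add[OF basis_facts(1,4,4)])

lemma coord_diff: "representation B (x - y) b = representation B x b - representation B y b"
  by (simp add: real_vector.representation_diff[OF basis_facts(1,4,4)])

lemma coord_scale: "representation B (r *\<^sub>R x) b = r * representation B x b"
  by (simp add: real_vector.representation_scale[OF basis_facts(1,4)])

lemma coord_basis: "v \<in> B \<Longrightarrow> representation B v b = (if b = v then 1 else 0)"
  by (simp add: real_vector.representation_basis[OF basis_facts(1)])

lemma coord_sum: "representation B (\<Sum>i\<in>I. f i) b = (\<Sum>i\<in>I. representation B (f i) b)"
  by (simp add: real_vector.representation_sum[OF basis_facts(1,4)])

lemma coord_of_combination:
  assumes "finite W" "B \<subseteq> W" "\<And>v. v \<in> W - B \<Longrightarrow> c v = 0" "b \<in> B"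
  shows "representation B (\<Sum>v\<in>W. c v *\<^sub>R v) b = c b"
proof -
  have "representation B (\<Sum>v\<in>W. c v *\<^sub>R v) b = (\<Sum>v\<in>W. c v * representation B v b)"
    by (simp add: coord_sum coord_scale)
  also have "\<dots> = (\<Sum>v\<in>{b}. c v * representation B v b)"
  proof (rule sum.mono_neutral_right)
    show "\<forall>i\<in>W - {b}. c i * representation B i b = 0"
    proof
      fix i assume i: "i \<in> W - {b}"
      show "c i * representation B i b = 0"
        using i assms(3)[of i] coord_basis[of i b] by (cases "i \<in> B") auto
    qed
  qed (use assms in auto)
  also have "\<dots> = c b" using coord_basis[OF assms(4), of b] by simp
  finally show ?thesis .
qed

lemma height_eq_sum_coord:
  assumes "linear ht" "\<And>v. v \<in> V \<Longrightarrow> ht v = 1"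
  shows "ht x = (\<Sum>b\<in>B. representation B x b)"
proof -
  have "ht x = (\<Sum>b\<in>B. representation B x b * ht b)"
    by (subst coord_expansion[of x, symmetric]) (simp add: linear_sum[OF assms(1)] linear_scale[OF assms(1)])
  also have "\<dots> = (\<Sum>b\<in>B. representation B x b)"
    using assms(2) basis_facts(3) by (intro sum.cong) auto
  finally show ?thesis .
qed

end

section \<open>Regular triangulation of a cone\<close>

text \<open>
  The value at \<open>y\<close> of the linear functional that interpolates the weights \<open>a\<close> on the basis \<open>B\<close>.
\<close>
definition basis_value :: "('a::real_vector \<Rightarrow> real) \<Rightarrow> 'a set \<Rightarrow> 'a \<Rightarrow> real" where
  "basis_value a B y = (\<Sum>b\<in>B. representation B y b * a b)"

text \<open>
  Lift each point \<open>v\<close> of \<open>V\<close> to height \<open>a v\<close>. The bases selected here are those whose lifted points span a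
  lower facet of the lifted configuration; the cones over them form the regular triangulation
  induced by \<open>a\<close>.
\<close>
definition regular_bases :: "('a::real_vector \<Rightarrow> real) \<Rightarrow> 'a set \<Rightarrow> 'a set set" where
  "regular_bases a V = {B \<in> bases_within V. \<forall>v\<in>V - B. basis_value a B v < a v}"

lemma basis_value_expand:
  fixes V :: "'a::euclidean_space set"
  assumes B: "B \<in> bases_within V" and B': "B' \<in> bases_within V"
  shows "basis_value a B' y = (\<Sum>b\<in>B. representation B y b * basis_value a B' b)"
proof -
  have "representation B' y b' = (\<Sum>b\<in>B. representation B y b * representation B' b b')" for b'
  proof -
    have "representation B' y b' = representation B' (\<Sum>b\<in>B. representation B y b *\<^sub>R b) b'"
      by (simp only: coord_expansion[OF B])
    then show ?thesis by (simp only: coord_sum[OF B'] coord_scale[OF B'])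
  qed
  then have "basis_value a B' y = (\<Sum>b'\<in>B'. \<Sum>b\<in>B. representation B y b * (representation B' b b' * a b'))"
    unfolding basis_value_def by (simp only: sum_distrib_right mult.assoc)
  also have "\<dots> = (\<Sum>b\<in>B. \<Sum>b'\<in>B'. representation B y b * (representation B' b b' * a b'))"
    by (rule sum.swap)
  also have "\<dots> = (\<Sum>b\<in>B. representation B y b * basis_value a B' b)"
    by (simp only: basis_value_def sum_distrib_left)
  finally show ?thesis .
qed

lemma basis_value_basis:
  fixes V :: "'a::euclidean_space set"
  assumes "B \<in> bases_within V" "v \<in> B"
  shows "basis_value a B v = a v"
proof -
  have "basis_value a B v = (\<Sum>b\<in>B. if b = v then a b else 0)"
    unfolding basis_value_def by (intro sum.cong) (auto simp: coord_basis[OF assms])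
  then show ?thesis using assms(2) basis_facts(2)[OF assms(1)] by simp
qed

text \<open>
  The functional of a regular basis never exceeds the weights and is strictly smaller off its own basis.
  Expanding \<open>y\<close> in another basis with positive coordinates therefore gives a strict comparison.
\<close>
lemma regular_basis_value_less:
  fixes V :: "'a::euclidean_space set"
  assumes B: "B \<in> bases_within V" and B': "B' \<in> regular_bases a V"
    and pos: "\<And>b. b \<in> B \<Longrightarrow> 0 < representation B y b" and nsub: "\<not> B \<subseteq> B'"
  shows "basis_value a B' y < basis_value a B y"
proof -
  have B'': "B' \<in> bases_within V" using B' by (simp add: regular_bases_def)
  have le: "basis_value a B' v \<le> a v" if "v \<in> V" for v
  proof (cases "v \<in> B'")
    case True
    then show ?thesis by (simp only: basis_value_basis[OF B''] order_refl)
  next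
    case False
    then have "basis_value a B' v < a v" using that B' by (simp add: regular_bases_def)
    then show ?thesis by simp
  qed
  obtain b0 where b0: "b0 \<in> B" "b0 \<notin> B'" using nsub by blast
  then have lt: "basis_value a B' b0 < a b0"
    using B' basis_facts(3)[OF B] unfolding regular_bases_def by blast
  have "(\<Sum>b\<in>B. representation B y b * basis_value a B' b) < (\<Sum>b\<in>B. representation B y b * a b)"
  proof (rule sum_strict_mono_ex1)
    show "finite B" using basis_facts(2)[OF B] .
    show "\<forall>x\<in>B. representation B y x * basis_value a B' x \<le> representation B y x * a x"
    proof
      fix x assume x: "x \<in> B"
      show "representation B y x * basis_value a B' x \<le> representation B y x * a x"
        using le[of x] pos[OF x] x basis_facts(3)[OF B] by (intro mult_left_mono) auto
    qed
    show "\<exists>b\<in>B. representation B y b * basis_value a B' b < representation B y b * a b"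
      using b0(1) mult_strict_left_mono[OF lt pos[OF b0(1)]] by blast
  qed
  then show ?thesis
    by (simp only: basis_value_expand[OF B B'', of a y] basis_value_def[of a B y])
qed

text \<open>
  If \<open>B\<close> and \<open>B'\<close> were different, neither would contain the other, and the preceding comparison would hold in both directions.
\<close>
lemma regular_cones_disjoint:
  fixes V :: "'a::euclidean_space set"
  assumes B: "B \<in> regular_bases a V" and B': "B' \<in> regular_bases a V"
    and "\<And>b. b \<in> B \<Longrightarrow> 0 < representation B y b" "\<And>b. b \<in> B' \<Longrightarrow> 0 < representation B' y b"
  shows "B = B'"
proof (rule ccontr)
  assume "B \<noteq> B'"
  have bs: "B \<in> bases_within V" "B' \<in> bases_within V" using B B' by (auto simp: regular_bases_def)
  have "\<not> B \<subseteq> B'" "\<not> B' \<subseteq> B"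
    using \<open>B \<noteq> B'\<close> card_subset_eq[of B' B] card_subset_eq[of B B'] basis_facts(2,5)[OF bs(1)] basis_facts(2,5)[OF bs(2)]
    by auto
  then show False
    using regular_basis_value_less[OF bs(1) B' assms(3)] regular_basis_value_less[OF bs(2) B assms(4)] by force
qed

text \<open>
  Extending the independent support of a reduced combination to a basis adds zero coordinates only.
\<close>
lemma basis_of_combination:
  fixes V :: "'a::euclidean_space set" and ht :: "'a \<Rightarrow> real"
  assumes V: "finite V" "span V = UNIV" "linear ht" "\<And>v. v \<in> V \<Longrightarrow> ht v = 1"
    and c: "\<And>v. v \<in> V \<Longrightarrow> 0 \<le> c v" and y: "y = (\<Sum>v\<in>V. c v *\<^sub>R v)"
  shows "\<exists>B\<in>bases_within V. (\<forall>b\<in>B. 0 \<le> representation B y b) \<and> basis_value a B y \<le> (\<Sum>v\<in>V. c v * a v)"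
proof -
  have "\<exists>c'. (\<forall>v\<in>V. 0 \<le> c' v) \<and> (\<Sum>v\<in>V. c' v *\<^sub>R v) = y \<and>
    (\<Sum>v\<in>V. c' v * a v) \<le> (\<Sum>v\<in>V. c v * a v) \<and> independent {v \<in> V. c' v \<noteq> 0}"
    unfolding y by (rule reduce_to_independent_support[OF V(1,3,4) c])
  then obtain c' where c': "\<forall>v\<in>V. 0 \<le> c' v" "(\<Sum>v\<in>V. c' v *\<^sub>R v) = y"
    "(\<Sum>v\<in>V. c' v * a v) \<le> (\<Sum>v\<in>V. c v * a v)" "independent {v \<in> V. c' v \<noteq> 0}"
    by blast
  obtain B where B: "{v \<in> V. c' v \<noteq> 0} \<subseteq> B" "B \<subseteq> V" "independent B" "V \<subseteq> span B"
    using real_vector.maximal_independent_subset_extend[OF _ c'(4), of V] by auto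
  then have Bb: "B \<in> bases_within V"
    using V(2) real_vector.span_minimal[OF B(4) real_vector.subspace_span] by (auto simp: bases_within_def)
  have rep: "representation B y b = c' b" if "b \<in> B" for b
    using coord_of_combination[OF Bb V(1) B(2) _ that, of c'] B(1) c'(2) by auto
  have "basis_value a B y = (\<Sum>v\<in>V. c' v * a v)"
    unfolding basis_value_def using B V(1) rep by (intro sum.mono_neutral_cong_left) auto
  then show ?thesis using Bb rep c' B by (intro bexI[of _ B]) auto
qed

lemma eventually_shift_pos:
  fixes f g :: "'b \<Rightarrow> real"
  assumes "finite B" "\<And>b. b \<in> B \<Longrightarrow> 0 < f b"
  shows "\<forall>\<^sub>F t in at_right 0. \<forall>b\<in>B. 0 < f b - t * g b"
proof (rule eventually_ball_finite[OF assms(1)], rule ballI)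
  fix b assume "b \<in> B"
  have "((\<lambda>t. f b - t * g b) \<longlongrightarrow> f b - 0 * g b) (at_right 0)" by (intro tendsto_intros)
  then show "\<forall>\<^sub>F t in at_right 0. 0 < f b - t * g b"
    using assms(2)[OF \<open>b \<in> B\<close>] by (intro order_tendstoD(1)) auto
qed

lemma finite_bases_within: "finite V \<Longrightarrow> finite (bases_within V)"
  by (rule finite_subset[of _ "Pow V"]) (auto simp: bases_within_def)

text \<open>
  Linear programming: among the bases that represent \<open>y\<close> with positive coordinates, one of least cost
  is regular. Otherwise some \<open>v\<close> has weight below the interpolating functional, and bringing \<open>v\<close> in with a small
  coefficient would represent \<open>y\<close> at lower cost. Genericity of \<open>y\<close> ensures that coordinates are never zero,
  genericity of \<open>a\<close> that comparisons of weights are never ties.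
\<close>
lemma regular_cones_cover:
  fixes V :: "'a::euclidean_space set" and ht :: "'a \<Rightarrow> real"
  assumes V: "finite V" "span V = UNIV" "linear ht" "\<And>v. v \<in> V \<Longrightarrow> ht v = 1"
    and a: "\<And>B v. B \<in> bases_within V \<Longrightarrow> v \<in> V - B \<Longrightarrow> basis_value a B v \<noteq> a v"
    and y: "y \<in> nonneg_cone V"
    and gen: "\<And>B b. B \<in> bases_within V \<Longrightarrow> b \<in> B \<Longrightarrow> representation B y b \<noteq> 0"
  shows "\<exists>B\<in>regular_bases a V. \<forall>b\<in>B. 0 < representation B y b"
proof -
  define F where "F = {B \<in> bases_within V. \<forall>b\<in>B. 0 < representation B y b}"
  have improve: "\<exists>B\<in>F. basis_value a B y \<le> (\<Sum>v\<in>V. c v * a v)"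
    if c: "\<And>v. v \<in> V \<Longrightarrow> 0 \<le> c v" "y = (\<Sum>v\<in>V. c v *\<^sub>R v)" for c
    using basis_of_combination[OF V c, of a] gen by (force simp: F_def less_le)
  have "finite F" using finite_bases_within[OF V(1)] by (simp add: F_def)
  have "F \<noteq> {}" using y improve by (auto simp: nonneg_cone_def)
  obtain B where BF: "B \<in> F" and min: "\<And>B'. B' \<in> F \<Longrightarrow> basis_value a B y \<le> basis_value a B' y"
    using ex_is_arg_min_if_finite[OF \<open>finite F\<close> \<open>F \<noteq> {}\<close>, of "\<lambda>B. basis_value a B y"]
    by (auto simp: is_arg_min_linorder)
  have B: "B \<in> bases_within V" and pos: "\<And>b. b \<in> B \<Longrightarrow> 0 < representation B y b"
    using BF by (auto simp: F_def)
  have "basis_value a B v < a v" if v: "v \<in> V - B" for v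
  proof (rule ccontr)
    assume "\<not> basis_value a B v < a v"
    then have gt: "a v < basis_value a B v" using a[OF B v] by auto
    have "\<forall>\<^sub>F t in at_right 0. 0 < t \<and> (\<forall>b\<in>B. 0 < representation B y b - t * representation B v b)"
      using eventually_shift_pos[OF basis_facts(2)[OF B] pos] 
      by (intro eventually_conj eventually_at_right_less) auto
    then obtain t where t: "0 < t" "\<And>b. b \<in> B \<Longrightarrow> 0 < representation B y b - t * representation B v b"
      using eventually_happens'[OF trivial_limit_at_right_real] by blast
    define c where "c = (\<lambda>u. if u = v then t else if u \<in> B then representation B y u - t * representation B v u else 0)"
    have split: "(\<Sum>u\<in>V. h u) = h v + (\<Sum>u\<in>B. h u)" if "\<And>u. u \<in> V - insert v B \<Longrightarrow> h u = 0" for h :: "'a \<Rightarrow> 'b::real_vector"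
    proof -
      have "(\<Sum>u\<in>V. h u) = (\<Sum>u\<in>insert v B. h u)"
        using V(1) v that basis_facts(3)[OF B] by (intro sum.mono_neutral_right) auto
      then show ?thesis using v basis_facts(2)[OF B] by simp
    qed
    have cB: "(\<Sum>u\<in>B. c u *\<^sub>R u) = y - t *\<^sub>R v"
    proof -
      have "(\<Sum>u\<in>B. c u *\<^sub>R u) = (\<Sum>u\<in>B. representation B y u *\<^sub>R u) - t *\<^sub>R (\<Sum>u\<in>B. representation B v u *\<^sub>R u)"
        unfolding scaleR_sum_right sum_subtractf[symmetric]
        using v by (intro sum.cong) (auto simp: c_def algebra_simps)
      then show ?thesis by (simp add: coord_expansion[OF B])
    qed
    have cBa: "(\<Sum>u\<in>B. c u * a u) = basis_value a B y - t * basis_value a B v"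
      unfolding basis_value_def sum_distrib_left sum_subtractf[symmetric]
      using v by (intro sum.cong) (auto simp: c_def algebra_simps)
    have "y = (\<Sum>u\<in>V. c u *\<^sub>R u)"
      using cB by (subst split) (auto simp: c_def)
    moreover have "0 \<le> c u" if "u \<in> V" for u
      using t by (auto simp: c_def less_imp_le)
    ultimately obtain B' where "B' \<in> F" "basis_value a B' y \<le> (\<Sum>u\<in>V. c u * a u)"
      using improve[of c] by blast
    moreover have "(\<Sum>u\<in>V. c u * a u) = basis_value a B y - t * (basis_value a B v - a v)"
      using cBa by (subst split) (auto simp: c_def algebra_simps)
    moreover have "t * (basis_value a B v - a v) > 0" using t gt by simp
    ultimately show False using min[of B'] by linarith
  qed
  then show ?thesis using B pos by (intro bexI[of _ B]) (auto simp: regular_bases_def)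
qed

section \<open>Half-open decomposition\<close>

text \<open>
  For \<open>A = B\<close> this is the simplicial cone over \<open>B\<close> without the facets opposite to the points of \<open>X\<close>, and for
  \<open>A = {}\<close> its half-open fundamental parallelepiped. The intermediate sets, unbounded in the
  directions of \<open>A\<close> only, allow passing from one to the other one generator at a time.
\<close>
definition half_open_box :: "'a::real_vector set \<Rightarrow> 'a set \<Rightarrow> 'a set \<Rightarrow> 'a set" where
  "half_open_box B X A = {x. \<forall>b\<in>B.
     (if b \<in> X then 0 < representation B x b \<and> (b \<in> A \<or> representation B x b \<le> 1)
      else 0 \<le> representation B x b \<and> (b \<in> A \<or> representation B x b < 1))}"

lemma half_open_box_subset_cone:
  fixes V :: "'a::euclidean_space set"
  assumes "finite V" and B: "B \<in> bases_within V"
  shows "half_open_box B X A \<subseteq> nonneg_cone V"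
proof
  fix x assume x: "x \<in> half_open_box B X A"
  define c where "c = (\<lambda>v. if v \<in> B then representation B x v else 0)"
  have "x = (\<Sum>v\<in>V. c v *\<^sub>R v)"
    unfolding c_def using assms basis_facts(3)[OF B]
    by (subst coord_expansion[OF B, symmetric], intro sum.mono_neutral_cong_left) auto
  moreover have "\<forall>v\<in>V. 0 \<le> c v"
    using x by (auto simp: c_def half_open_box_def split: if_splits dest!: bspec)
  ultimately show "x \<in> nonneg_cone V" by (auto simp: nonneg_cone_def)
qed

text \<open>
  Used with a coordinate \<open>p\<close> of a point and the same coordinate \<open>q\<close> of the generic direction: the sign after a small
  perturbation is the lexicographic sign of \<open>(p, q)\<close>, which decides on which side of a facet a point on it is counted.
\<close>
lemma eventually_lex_sign:
  fixes p q :: real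
  assumes "q \<noteq> 0"
  shows "\<forall>\<^sub>F t in at_right 0. p + t * q \<noteq> 0 \<and> (0 < p + t * q \<longleftrightarrow> (if q < 0 then 0 < p else 0 \<le> p))"
proof (cases "p = 0")
  case True
  show ?thesis
    by (rule eventually_mono[OF eventually_at_right_less[of 0]])
      (use True assms in \<open>auto simp: zero_less_mult_iff\<close>)
next
  case False
  have lim: "((\<lambda>t. p + t * q) \<longlongrightarrow> p + 0 * q) (at_right 0)" by (intro tendsto_intros)
  show ?thesis
  proof (cases "p > 0")
    case True
    then have "\<forall>\<^sub>F t in at_right 0. 0 < p + t * q" using lim by (intro order_tendstoD(1)) auto
    then show ?thesis by eventually_elim (use True in auto)
  next
    case p: False
    then have "\<forall>\<^sub>F t in at_right 0. p + t * q < 0" using lim False by (intro order_tendstoD(2)) auto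
    then show ?thesis by eventually_elim (use p False in auto)
  qed
qed

text \<open>
  Fix a generic point \<open>w\<close> of the cone. A point \<open>x\<close> is assigned to the cell whose interior contains \<open>x + t w\<close> for
  small \<open>t > 0\<close>; this is unambiguous because \<open>x + t w\<close> is generic. In coordinates the cell of \<open>B\<close> is
  the closed cone without the facets that separate it from \<open>w\<close>. No cell loses all of its facets:
  otherwise all coordinates of \<open>w\<close> would be negative, contradicting that \<open>w\<close> has positive height.
\<close>
theorem half_open_decomposition:
  fixes V :: "'a::euclidean_space set" and ht :: "'a \<Rightarrow> real"
  assumes V: "finite V" "span V = UNIV" "linear ht" "\<And>v. v \<in> V \<Longrightarrow> ht v = 1"
  obtains T X where "finite T" "T \<subseteq> bases_within V" "\<forall>B\<in>T. X B \<subset> B"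
    "nonneg_cone V = (\<Union>B\<in>T. half_open_box B (X B) B)"
    "disjoint_family_on (\<lambda>B. half_open_box B (X B) B) T"
proof -
  let ?\<B> = "bases_within V"
  have fin: "finite ?\<B>" using finite_bases_within[OF V(1)] .
  \<comment> \<open>\<open>G1\<close> makes the coordinates of \<open>w\<close> nonzero, \<open>G2\<close> excludes ties between weights; the same weights serve both purposes.\<close>
  define G1 where "G1 = (\<lambda>(B, b) v. representation B v b) ` (Sigma ?\<B> (\<lambda>B. B))"
  define G2 where "G2 = (\<lambda>(B, v) u. (if u = v then 1 else 0) - (if u \<in> B then representation B v u else 0))
      ` (Sigma ?\<B> (\<lambda>B. V - B))"
  have "\<exists>a. (\<forall>v\<in>V. 0 < a v) \<and> (\<forall>g\<in>G1 \<union> G2. (\<Sum>v\<in>V. g v * a v) \<noteq> 0)"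
  proof (rule generic_weights[OF V(1)])
    show "finite (G1 \<union> G2)"
      unfolding G1_def G2_def using fin V(1) basis_facts(2) by (intro finite_UnI finite_imageI finite_SigmaI) auto
    fix g assume "g \<in> G1 \<union> G2"
    then show "\<exists>v\<in>V. g v \<noteq> 0"
    proof
      assume "g \<in> G1"
      then obtain B b where "B \<in> ?\<B>" "b \<in> B" "g = (\<lambda>v. representation B v b)" by (auto simp: G1_def)
      then show ?thesis using basis_facts(3)[of B V] coord_basis[of B V b b] by (intro bexI[of _ b]) auto
    next
      assume "g \<in> G2"
      then obtain B v where "B \<in> ?\<B>" "v \<in> V - B"
        "g = (\<lambda>u. (if u = v then 1 else 0) - (if u \<in> B then representation B v u else 0))" by (auto simp: G2_def)
      then show ?thesis by (intro bexI[of _ v]) auto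
    qed
  qed
  then obtain a where a: "\<And>v. v \<in> V \<Longrightarrow> 0 < a v" "\<And>g. g \<in> G1 \<union> G2 \<Longrightarrow> (\<Sum>v\<in>V. g v * a v) \<noteq> 0" by blast
  define w where "w = (\<Sum>v\<in>V. a v *\<^sub>R v)"
  have w_gen: "representation B w b \<noteq> 0" if "B \<in> ?\<B>" "b \<in> B" for B b
  proof -
    have "(\<lambda>v. representation B v b) \<in> G1" using that by (force simp: G1_def)
    then show ?thesis using a(2)[of "\<lambda>v. representation B v b"]
      by (simp add: w_def coord_sum[OF that(1)] coord_scale[OF that(1)] mult.commute)
  qed
  have a_gen: "basis_value a B v \<noteq> a v" if "B \<in> ?\<B>" "v \<in> V - B" for B v
  proof -
    have "(\<lambda>u. (if u = v then 1 else 0) - (if u \<in> B then representation B v u else 0)) \<in> G2"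
      using that by (force simp: G2_def)
    from a(2)[OF UnI2[OF this]]
    have "(\<Sum>u\<in>V. ((if u = v then 1 else 0) - (if u \<in> B then representation B v u else 0)) * a u) \<noteq> 0" .
    moreover have "(\<Sum>u\<in>V. ((if u = v then 1 else 0) - (if u \<in> B then representation B v u else 0)) * a u)
        = (\<Sum>u\<in>V. (if u = v then a u else 0) - (if u \<in> B then representation B v u * a u else 0))"
      by (intro sum.cong) (auto simp: left_diff_distrib)
    moreover have "(\<Sum>u\<in>V. if u \<in> B then representation B v u * a u else 0) = basis_value a B v"
      unfolding basis_value_def using V(1) basis_facts(3)[OF that(1)]
      by (intro sum.mono_neutral_cong_right) auto
    ultimately show ?thesis using V(1) that by (simp add: sum_subtractf)
  qed
  define X where "X = (\<lambda>B. {b\<in>B. representation B w b < 0})"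
  define T where "T = regular_bases a V"
  have T: "T \<subseteq> ?\<B>" "finite T" using fin by (auto simp: T_def regular_bases_def)
  have X: "X B \<subset> B" if "B \<in> T" for B
  proof -
    have B: "B \<in> ?\<B>" using that T by auto
    have "V \<noteq> {}" using basis_facts(3,5)[OF B] DIM_positive[where 'a='a] by force
    have "ht w = (\<Sum>v\<in>V. a v)"
      unfolding w_def using V(3,4) by (simp add: linear_sum linear_scale)
    also have "\<dots> > 0" using V(1) a(1) \<open>V \<noteq> {}\<close> by (intro sum_pos) auto
    finally have "(\<Sum>b\<in>B. representation B w b) > 0" using height_eq_sum_coord[OF B V(3,4)] by simp
    then have "\<not> (\<forall>b\<in>B. representation B w b < 0)"
      using sum_nonpos[of B "representation B w"] by (force simp: less_imp_le)
    then show ?thesis by (auto simp: X_def)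
  qed
  have sgn: "\<forall>\<^sub>F t in at_right 0. t > 0 \<and> (\<forall>B\<in>?\<B>. \<forall>b\<in>B. representation B (x + t *\<^sub>R w) b \<noteq> 0 \<and>
      (0 < representation B (x + t *\<^sub>R w) b \<longleftrightarrow>
         (if b \<in> X B then 0 < representation B x b else 0 \<le> representation B x b)))" for x
  proof (rule eventually_conj[OF eventually_at_right_less], intro eventually_ball_finite fin ballI)
    fix B assume B: "B \<in> ?\<B>"
    then show "finite B" by (rule basis_facts(2))
    fix b assume b: "b \<in> B"
    show "\<forall>\<^sub>F t in at_right 0. representation B (x + t *\<^sub>R w) b \<noteq> 0 \<and>
      (0 < representation B (x + t *\<^sub>R w) b \<longleftrightarrow>
         (if b \<in> X B then 0 < representation B x b else 0 \<le> representation B x b))"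
      using eventually_lex_sign[OF w_gen[OF B b], of "representation B x b"] b
      by (simp add: coord_add[OF B] coord_scale[OF B] X_def)
  qed
  have sgn': "\<exists>t>0. (\<forall>B\<in>?\<B>. \<forall>b\<in>B. representation B (x + t *\<^sub>R w) b \<noteq> 0) \<and>
     (\<forall>B\<in>?\<B>. x \<in> half_open_box B (X B) B \<longleftrightarrow> (\<forall>b\<in>B. 0 < representation B (x + t *\<^sub>R w) b))" for x
  proof -
    obtain t where t: "t > 0" "\<And>B b. B \<in> ?\<B> \<Longrightarrow> b \<in> B \<Longrightarrow> representation B (x + t *\<^sub>R w) b \<noteq> 0"
      "\<And>B b. B \<in> ?\<B> \<Longrightarrow> b \<in> B \<Longrightarrow> 0 < representation B (x + t *\<^sub>R w) b \<longleftrightarrow>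
         (if b \<in> X B then 0 < representation B x b else 0 \<le> representation B x b)"
      using eventually_happens'[OF trivial_limit_at_right_real sgn[of x]] by blast
    have "x \<in> half_open_box B (X B) B \<longleftrightarrow> (\<forall>b\<in>B. 0 < representation B (x + t *\<^sub>R w) b)"
      if "B \<in> ?\<B>" for B
      unfolding half_open_box_def mem_Collect_eq using t(3)[OF that] by (intro ball_cong) auto
    then show ?thesis using t(1,2) by blast
  qed
  have "nonneg_cone V = (\<Union>B\<in>T. half_open_box B (X B) B)"
  proof
    show "(\<Union>B\<in>T. half_open_box B (X B) B) \<subseteq> nonneg_cone V"
      using half_open_box_subset_cone[OF V(1)] T by auto
    show "nonneg_cone V \<subseteq> (\<Union>B\<in>T. half_open_box B (X B) B)"
    proof
      fix x assume "x \<in> nonneg_cone V"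
      then obtain c where c: "\<And>v. v \<in> V \<Longrightarrow> 0 \<le> c v" "x = (\<Sum>v\<in>V. c v *\<^sub>R v)" by (auto simp: nonneg_cone_def)
      obtain t where t: "t > 0" "\<forall>B\<in>?\<B>. \<forall>b\<in>B. representation B (x + t *\<^sub>R w) b \<noteq> 0"
        "\<forall>B\<in>?\<B>. x \<in> half_open_box B (X B) B \<longleftrightarrow> (\<forall>b\<in>B. 0 < representation B (x + t *\<^sub>R w) b)"
        using sgn' by blast
      have "x + t *\<^sub>R w = (\<Sum>v\<in>V. (c v + t * a v) *\<^sub>R v)"
        by (simp add: c w_def scaleR_left_distrib sum.distrib scaleR_sum_right)
      moreover have "\<forall>v\<in>V. 0 \<le> c v + t * a v" 
        using c(1) a(1) t(1) by (intro ballI add_nonneg_nonneg mult_nonneg_nonneg) (auto intro: less_imp_le)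
      ultimately have "x + t *\<^sub>R w \<in> nonneg_cone V" by (force simp: nonneg_cone_def)
      then obtain B where "B \<in> T" "\<forall>b\<in>B. 0 < representation B (x + t *\<^sub>R w) b"
        using regular_cones_cover[OF V a_gen] t(2) unfolding T_def by blast
      then show "x \<in> (\<Union>B\<in>T. half_open_box B (X B) B)" using t(3) T by blast
    qed
  qed
  moreover have "disjoint_family_on (\<lambda>B. half_open_box B (X B) B) T"
    unfolding disjoint_family_on_def
  proof (intro ballI impI)
    fix B B' assume BB: "B \<in> T" "B' \<in> T" "B \<noteq> B'"
    show "half_open_box B (X B) B \<inter> half_open_box B' (X B') B' = {}"
    proof (rule ccontr)
      assume "half_open_box B (X B) B \<inter> half_open_box B' (X B') B' \<noteq> {}"
      then obtain x where x: "x \<in> half_open_box B (X B) B" "x \<in> half_open_box B' (X B') B'" by blast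
      obtain t where "\<forall>B\<in>?\<B>. x \<in> half_open_box B (X B) B \<longleftrightarrow> (\<forall>b\<in>B. 0 < representation B (x + t *\<^sub>R w) b)"
        using sgn' by blast
      then have "\<forall>b\<in>B. 0 < representation B (x + t *\<^sub>R w) b" "\<forall>b\<in>B'. 0 < representation B' (x + t *\<^sub>R w) b"
        using x BB T by blast+
      then show False using regular_cones_disjoint BB unfolding T_def by blast
    qed
  qed
  ultimately show thesis using that[of T X] T X by blast
qed

section \<open>Counting lattice points in slices of the cone\<close>
definition slice_count :: "((real ^ 'd) \<times> real) set \<Rightarrow> real \<Rightarrow> nat" where
  "slice_count S s = card {y \<in> integer_points. (y, s) \<in> S}"

definition lift_points :: "(real ^ 'd) set \<Rightarrow> ((real ^ 'd) \<times> real) set" where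
  "lift_points W = (\<lambda>v. (v, 1)) ` W"

text \<open>
  The cone over the lifted points collects all dilates: its slice at height \<open>s\<close> is the \<open>s\<close>-th dilate of the polytope.
\<close>
lemma nonneg_cone_lift_points:
  fixes W :: "(real ^ 'd) set"
  assumes "finite W" "W \<noteq> {}"
  shows "(y, s) \<in> nonneg_cone (lift_points W) \<longleftrightarrow> 0 \<le> s \<and> y \<in> dilate s (convex hull W)"
proof -
  have "(y, s) \<in> nonneg_cone (lift_points W) \<longleftrightarrow>
      (\<exists>c. (\<forall>v\<in>W. 0 \<le> c v) \<and> y = (\<Sum>v\<in>W. c v *\<^sub>R v) \<and> s = sum c W)" (is "?L \<longleftrightarrow> ?R")
  proof
    assume ?L
    then obtain c where c: "\<forall>v\<in>lift_points W. 0 \<le> c v" "(y, s) = (\<Sum>v\<in>lift_points W. c v *\<^sub>R v)"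
      unfolding nonneg_cone_def by blast
    have "(y, s) = (\<Sum>v\<in>W. c (v, 1) *\<^sub>R (v, 1))"
      using c(2) by (simp add: lift_points_def sum.reindex inj_on_def)
    then have "y = (\<Sum>v\<in>W. c (v, 1) *\<^sub>R v)" "s = (\<Sum>v\<in>W. c (v, 1))"
      by (auto simp: sum_prod)
    then show ?R using c(1) by (intro exI[of _ "\<lambda>v. c (v, 1)"]) (auto simp: lift_points_def)
  next
    assume ?R
    then obtain c where c: "\<forall>v\<in>W. 0 \<le> c v" "y = (\<Sum>v\<in>W. c v *\<^sub>R v)" "s = sum c W" by blast
    then have "(y, s) = (\<Sum>v\<in>W. c v *\<^sub>R (v, 1))" by (simp add: sum_prod)
    also have "\<dots> = (\<Sum>v\<in>lift_points W. c (fst v) *\<^sub>R v)"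
      by (simp add: lift_points_def sum.reindex inj_on_def)
    finally show ?L unfolding nonneg_cone_def using c(1)
      by (intro CollectI exI[of _ "\<lambda>v. c (fst v)"]) (auto simp: lift_points_def)
  qed
  also have "\<dots> \<longleftrightarrow> 0 \<le> s \<and> y \<in> dilate s (convex hull W)" (is "_ \<longleftrightarrow> ?D")
  proof
    assume ?R
    then obtain c where c: "\<forall>v\<in>W. 0 \<le> c v" "y = (\<Sum>v\<in>W. c v *\<^sub>R v)" "s = sum c W" by blast
    have s0: "0 \<le> s" using c by (auto intro: sum_nonneg)
    show ?D
    proof (cases "s = 0")
      case True
      then have "\<forall>v\<in>W. c v = 0" using c assms(1) sum_nonneg_eq_0_iff[of W c] by auto
      then have "y = 0" using c by simp
      moreover obtain x where "x \<in> W" using assms(2) by blast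
      ultimately show ?thesis using True hull_inc[of x W] by (force simp: dilate_def)
    next
      case False
      have "(\<Sum>v\<in>W. (c v / s) *\<^sub>R v) \<in> convex hull W"
        unfolding convex_hull_finite[OF assms(1)] using c s0 False
        by (intro CollectI exI[of _ "\<lambda>v. c v / s"]) (auto simp flip: sum_divide_distrib)
      moreover have "y = s *\<^sub>R (\<Sum>v\<in>W. (c v / s) *\<^sub>R v)"
        using False by (simp add: c scaleR_sum_right)
      ultimately show ?thesis using s0 by (auto simp: dilate_def)
    qed
  next
    assume D: ?D
    then obtain x where x: "x \<in> convex hull W" "y = s *\<^sub>R x" by (auto simp: dilate_def)
    then obtain u where u: "\<forall>v\<in>W. 0 \<le> u v" "sum u W = 1" "(\<Sum>v\<in>W. u v *\<^sub>R v) = x"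
      unfolding convex_hull_finite[OF assms(1)] by blast
    then show ?R using D x
      by (intro exI[of _ "\<lambda>v. s * u v"]) (auto simp: scaleR_sum_right simp flip: sum_distrib_left)
  qed
  finally show ?thesis .
qed

lemma span_lift_points:
  fixes W :: "(real ^ 'd) set"
  assumes "affine hull W = UNIV"
  shows "span (lift_points W) = UNIV"
proof -
  have 1: "(x, 1) \<in> span (lift_points W)" for x :: "real ^ 'd"
  proof -
    have "x \<in> affine hull W" using assms by simp
    then obtain S u where S: "finite S" "S \<subseteq> W" "sum u S = 1" "(\<Sum>v\<in>S. u v *\<^sub>R v) = x"
      unfolding affine_hull_explicit by blast
    have "(x, 1) = (\<Sum>v\<in>S. u v *\<^sub>R (v, 1 :: real))" using S by (simp add: sum_prod)
    also have "\<dots> \<in> span (lift_points W)"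
      using S(2) by (intro span_sum span_scale span_base) (auto simp: lift_points_def)
    finally show ?thesis .
  qed
  have "(x, s) \<in> span (lift_points W)" for x :: "real ^ 'd" and s
  proof -
    have "(x, s) = (x, 1) + (s - 1) *\<^sub>R (0, 1)" by simp
    then show ?thesis by (metis 1 span_add span_scale)
  qed
  then show ?thesis by auto
qed

lemma finite_integer_points_bounded:
  fixes S :: "(real ^ 'd) set"
  assumes "bounded S"
  shows "finite (S \<inter> integer_points)"
proof -
  obtain K where K: "\<And>x. x \<in> S \<Longrightarrow> norm x \<le> K" using assms by (auto simp: bounded_iff)
  have "S \<inter> integer_points \<subseteq> {x. \<forall>i. x $ i \<in> of_int ` {-\<lceil>K\<rceil>..\<lceil>K\<rceil>}}"
  proof
    fix x assume x: "x \<in> S \<inter> integer_points"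
    have "x $ i \<in> of_int ` {-\<lceil>K\<rceil>..\<lceil>K\<rceil>}" for i
    proof -
      obtain k where k: "x $ i = of_int k" using x by (auto simp: integer_points_def elim: Ints_cases)
      have "\<bar>x $ i\<bar> \<le> K" using component_le_norm_cart[of x i] K[of x] x by auto
      then have "k \<in> {-\<lceil>K\<rceil>..\<lceil>K\<rceil>}" unfolding k by (auto simp: abs_le_iff) linarith+
      then show ?thesis using k by auto
    qed
    then show "x \<in> {x. \<forall>i. x $ i \<in> of_int ` {-\<lceil>K\<rceil>..\<lceil>K\<rceil>}}" by blast
  qed
  also have "\<dots> \<subseteq> vec_lambda ` (UNIV \<rightarrow>\<^sub>E of_int ` {-\<lceil>K\<rceil>..\<lceil>K\<rceil>})"
  proof
    fix x :: "real ^ 'd" assume x: "x \<in> {x. \<forall>i. x $ i \<in> of_int ` {-\<lceil>K\<rceil>..\<lceil>K\<rceil>}}"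
    have "x = vec_lambda (\<lambda>i. x $ i)" by simp
    then show "x \<in> vec_lambda ` (UNIV \<rightarrow>\<^sub>E of_int ` {-\<lceil>K\<rceil>..\<lceil>K\<rceil>})"
      using x by (intro image_eqI[of x vec_lambda "\<lambda>i. x $ i"]) auto
  qed
  finally show ?thesis by (rule finite_subset) (intro finite_imageI finite_PiE, auto)
qed

lemma finite_cone_slice:
  fixes W :: "(real ^ 'd) set"
  assumes "finite W" "W \<noteq> {}" "S \<subseteq> nonneg_cone (lift_points W)"
  shows "finite {y \<in> integer_points. (y, s) \<in> S}"
proof -
  have "bounded (dilate s (convex hull W))"
    unfolding dilate_def by (intro bounded_scaling bounded_convex_hull finite_imp_bounded assms)
  then show ?thesis
    by (rule finite_subset[rotated, OF finite_integer_points_bounded])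
      (use assms nonneg_cone_lift_points[OF assms(1,2)] in blast)
qed

text \<open>
  Releasing the upper bound on the coordinate at \<open>b\<close> tiles the larger set by the smaller one and the
  translate by \<open>b\<close> of the larger one. The closed or open side conditions are arranged so that the tiling
  is disjoint.
\<close>
lemma half_open_box_insert:
  fixes V :: "'a::euclidean_space set"
  assumes B: "B \<in> bases_within V" and b: "b \<in> B" "b \<notin> A"
  shows "x \<in> half_open_box B X (insert b A) \<longleftrightarrow>
      x \<in> half_open_box B X A \<or> x - b \<in> half_open_box B X (insert b A)"
    and "\<not> (x \<in> half_open_box B X A \<and> x - b \<in> half_open_box B X (insert b A))"
proof -
  define good where "good = (\<lambda>A c t. if c \<in> X then 0 < t \<and> (c \<in> A \<or> t \<le> (1::real))
      else 0 \<le> t \<and> (c \<in> A \<or> t < 1))"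
  have box: "y \<in> half_open_box B X D \<longleftrightarrow>
      good D b (representation B y b) \<and> (\<forall>c\<in>B - {b}. good D c (representation B y c))" for y D
    using b by (auto simp: half_open_box_def good_def)
  have r: "representation B (x - b) c = representation B x c - (if c = b then 1 else 0)" for c
    by (simp add: coord_diff[OF B] coord_basis[OF B b(1)])
  have other: "good (insert b A) c t \<longleftrightarrow> good A c t" if "c \<in> B - {b}" for c t
    using that by (auto simp: good_def)
  have split: "good (insert b A) b t \<longleftrightarrow> good A b t \<or> good (insert b A) b (t - 1)"
    "\<not> (good A b t \<and> good (insert b A) b (t - 1))" for t
    using b(2) by (auto simp: good_def)
  have o: "(\<forall>c\<in>B - {b}. good (insert b A) c (representation B y c)) \<longleftrightarrow>
      (\<forall>c\<in>B - {b}. good A c (representation B y c))" for y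
    using other by blast
  have r': "(\<forall>c\<in>B - {b}. good A c (representation B (x - b) c)) \<longleftrightarrow>
      (\<forall>c\<in>B - {b}. good A c (representation B x c))"
    by (intro ball_cong) (auto simp: r)
  have rb: "representation B (x - b) b = representation B x b - 1" by (simp add: r)
  show "x \<in> half_open_box B X (insert b A) \<longleftrightarrow>
      x \<in> half_open_box B X A \<or> x - b \<in> half_open_box B X (insert b A)"
    unfolding box o r' rb using split(1) by blast
  show "\<not> (x \<in> half_open_box B X A \<and> x - b \<in> half_open_box B X (insert b A))"
    unfolding box o r' rb using split(2) by blast
qed

lemma slice_count_insert:
  fixes W :: "(real ^ 'd) set"
  assumes W: "finite W" "W \<noteq> {}" "W \<subseteq> integer_points"
    and B: "B \<in> bases_within (lift_points W)" and b: "b \<in> B" "b \<notin> A"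
  shows "slice_count (half_open_box B X (insert b A)) s =
    slice_count (half_open_box B X A) s + slice_count (half_open_box B X (insert b A)) (s - 1)"
proof -
  obtain v where v: "v \<in> W" "b = (v, 1)"
    using b(1) basis_facts(3)[OF B] by (auto simp: lift_points_def)
  then have vi: "v \<in> integer_points" using W by auto
  let ?N = "\<lambda>A s. {y \<in> integer_points. (y, s) \<in> half_open_box B X A}"
  have fin: "finite (?N A s)" for A s
    using half_open_box_subset_cone[OF _ B] W by (intro finite_cone_slice[OF W(1,2)]) (auto simp: lift_points_def)
  have shift: "(y, s) - b = (y - v, s - 1)" for y by (simp add: v)
  have "?N (insert b A) s = ?N A s \<union> (\<lambda>y. y + v) ` ?N (insert b A) (s - 1)"
  proof (intro set_eqI iffI)
    fix y assume y: "y \<in> ?N (insert b A) s"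
    show "y \<in> ?N A s \<union> (\<lambda>y. y + v) ` ?N (insert b A) (s - 1)"
    proof (cases "(y, s) \<in> half_open_box B X A")
      case False
      then have "(y - v, s - 1) \<in> half_open_box B X (insert b A)"
        using y half_open_box_insert(1)[OF B b, of "(y, s)" X] by (auto simp: shift)
      moreover have "y - v \<in> integer_points" using y vi by (auto simp: integer_points_def)
      ultimately have "y - v \<in> ?N (insert b A) (s - 1)" by blast
      then have "y - v + v \<in> (\<lambda>y. y + v) ` ?N (insert b A) (s - 1)" by (rule imageI)
      then show ?thesis by simp
    qed (use y in auto)
  next
    fix y assume "y \<in> ?N A s \<union> (\<lambda>y. y + v) ` ?N (insert b A) (s - 1)"
    then show "y \<in> ?N (insert b A) s"
    proof
      assume "y \<in> ?N A s"
      then show ?thesis using half_open_box_insert(1)[OF B b, of "(y, s)" X] by auto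
    next
      assume "y \<in> (\<lambda>y. y + v) ` ?N (insert b A) (s - 1)"
      then obtain z where "z \<in> ?N (insert b A) (s - 1)" "y = z + v" by blast
      then show ?thesis using half_open_box_insert(1)[OF B b, of "(y, s)" X] vi
        by (auto simp: shift integer_points_def)
    qed
  qed
  moreover have "?N A s \<inter> (\<lambda>y. y + v) ` ?N (insert b A) (s - 1) = {}"
  proof -
    have "(y - v, s - 1) \<notin> half_open_box B X (insert b A)" if "(y, s) \<in> half_open_box B X A" for y
      using half_open_box_insert(2)[OF B b, of "(y, s)" X] that by (simp add: shift)
    then have "z \<notin> ?N (insert b A) (s - 1)" if "z + v \<in> ?N A s" for z
      using that by fastforce
    then show ?thesis by blast
  qed
  moreover have "card ((\<lambda>y. y + v) ` ?N (insert b A) (s - 1)) = card (?N (insert b A) (s - 1))"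
    by (rule card_image) (auto simp: inj_on_def)
  ultimately show ?thesis
    unfolding slice_count_def using fin by (simp add: card_Un_disjoint)
qed

text \<open>
  Real heights are sampled along a progression of step \<open>1/m\<close>; the offset \<open>s\<close> makes the series usable both for
  the Ehrhart series (\<open>s = 0\<close>) and for one residue class of heights modulo \<open>1\<close> (\<open>m = 1\<close>).
\<close>
definition count_series :: "(real \<Rightarrow> nat) \<Rightarrow> real \<Rightarrow> nat \<Rightarrow> rat fps" where
  "count_series f s m = Abs_fps (\<lambda>n. of_nat (f (s + real n / real m)))"

text \<open>
  Lowering the height by \<open>1\<close> is a shift of the series by \<open>m\<close> places. The bound on \<open>s\<close> makes the first \<open>m\<close>
  sampled heights fall below \<open>1\<close>, where the recursion reaches a negative height and contributes nothing.
\<close>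
lemma count_series_difference:
  assumes m: "m > 0" and s: "s < 1 / real m" and neg: "\<And>t. t < 0 \<Longrightarrow> f t = 0"
    and rec: "\<And>t. f t = g t + f (t - 1)"
  shows "count_series f s m * (1 - fps_X ^ m) = count_series g s m"
proof (rule fps_ext)
  fix n
  have "f (s + real n / real m - 1) = (if n < m then 0 else f (s + real (n - m) / real m))"
  proof (cases "n < m")
    case True
    then have "real n + 1 \<le> real m" by linarith
    then have "(real n + 1) / real m \<le> 1" using m by simp
    then have "s + real n / real m - 1 < 0" using s by (simp add: add_divide_distrib)
    then show ?thesis using neg True by simp
  next
    case False
    then have "s + real n / real m - 1 = s + real (n - m) / real m"
      using m by (simp add: of_nat_diff field_simps)
    then show ?thesis by (simp only: if_not_P[OF False])
  qed
  then show "fps_nth (count_series f s m * (1 - fps_X ^ m)) n = fps_nth (count_series g s m) n"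
    using rec[of "s + real n / real m"]
    by (simp add: count_series_def right_diff_distrib fps_X_power_mult_right_nth)
qed

lemma slice_count_negative_height:
  fixes W :: "(real ^ 'd) set"
  assumes "finite W" "W \<noteq> {}" "S \<subseteq> nonneg_cone (lift_points W)" "s < 0"
  shows "slice_count S s = 0"
proof -
  have "{y \<in> integer_points. (y, s) \<in> S} = {}"
    using assms nonneg_cone_lift_points[OF assms(1,2), of _ s] by auto
  then show ?thesis unfolding slice_count_def by (simp only: card.empty)
qed

lemma count_series_half_open_cone:
  fixes W :: "(real ^ 'd) set"
  assumes W: "finite W" "W \<noteq> {}" "W \<subseteq> integer_points"
    and B: "B \<in> bases_within (lift_points W)" and m: "m > 0" "s < 1 / real m"
  shows "count_series (slice_count (half_open_box B X B)) s m * (1 - fps_X ^ m) ^ (CARD('d) + 1) =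
    count_series (slice_count (half_open_box B X {})) s m"
proof -
  have sub: "half_open_box B X A \<subseteq> nonneg_cone (lift_points W)" for A
    using half_open_box_subset_cone[OF _ B] W(1) by (auto simp: lift_points_def)
  have "count_series (slice_count (half_open_box B X A)) s m * (1 - fps_X ^ m) ^ card A =
    count_series (slice_count (half_open_box B X {})) s m" if "A \<subseteq> B" for A
    using finite_subset[OF that basis_facts(2)[OF B]] that
  proof (induction A rule: finite_induct)
    case (insert b A)
    have "count_series (slice_count (half_open_box B X (insert b A))) s m * (1 - fps_X ^ m) =
        count_series (slice_count (half_open_box B X A)) s m"
    proof (rule count_series_difference[OF m])
      show "slice_count (half_open_box B X (insert b A)) t = 0" if "t < 0" for t
        using slice_count_negative_height[OF W(1,2) sub that] .
      show "slice_count (half_open_box B X (insert b A)) t =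
          slice_count (half_open_box B X A) t + slice_count (half_open_box B X (insert b A)) (t - 1)" for t
        using insert.hyps insert.prems by (intro slice_count_insert[OF W B]) auto
    qed
    then show ?case using insert by (simp flip: mult.assoc)
  qed simp
  from this[OF order_refl] show ?thesis using basis_facts(5)[OF B] by simp
qed

text \<open>
  The height is the sum of the coordinates. At least one of them is strictly below \<open>1\<close> because not all facets are
  removed; this strictness makes the numerator vanish already at height \<open>d + 1\<close>.
\<close>
lemma slice_count_box_high:
  fixes W :: "(real ^ 'd) set"
  assumes B: "B \<in> bases_within (lift_points W)" and X: "X \<subset> B" and s: "s \<ge> real CARD('d) + 1"
  shows "slice_count (half_open_box B X {}) s = 0"
proof -
  have "(y, s) \<notin> half_open_box B X {}" for y
  proof
    assume y: "(y, s) \<in> half_open_box B X {}"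
    have ht: "linear snd" "\<And>v. v \<in> lift_points W \<Longrightarrow> snd v = 1" by (auto simp: lift_points_def linear_snd)
    obtain b where b: "b \<in> B" "b \<notin> X" using X by blast
    have "s = (\<Sum>b\<in>B. representation B (y, s) b)" using height_eq_sum_coord[OF B ht, of "(y, s)"] by simp
    also have "\<dots> < (\<Sum>b\<in>B. 1)"
    proof (rule sum_strict_mono_ex1[OF basis_facts(2)[OF B]])
      show "\<forall>c\<in>B. representation B (y, s) c \<le> 1"
      proof
        fix c assume "c \<in> B"
        then show "representation B (y, s) c \<le> 1"
          using bspec[OF y[unfolded half_open_box_def mem_Collect_eq], of c] by (auto split: if_splits)
      qed
      have "representation B (y, s) b < 1"
        using bspec[OF y[unfolded half_open_box_def mem_Collect_eq] b(1)] b(2) by simp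
      then show "\<exists>c\<in>B. representation B (y, s) c < 1" using b(1) by blast
    qed
    also have "\<dots> = real CARD('d) + 1" using basis_facts(5)[OF B] by simp
    finally show False using s by simp
  qed
  then show ?thesis unfolding slice_count_def by simp
qed

text \<open>
  Here \<open>p s\<close> counts the lattice points at height \<open>s\<close> in the half-open fundamental parallelepipeds of all
  cells. It is the same function for all step sizes and offsets.
\<close>
theorem count_series_lattice_polytope:
  fixes W :: "(real ^ 'd) set"
  assumes W: "finite W" "W \<subseteq> integer_points" "affine hull W = UNIV"
  obtains p :: "real \<Rightarrow> nat" where "\<And>s. s \<ge> real CARD('d) + 1 \<Longrightarrow> p s = 0"
    "\<And>m s. m > 0 \<Longrightarrow> 0 \<le> s \<Longrightarrow> s < 1 / real m \<Longrightarrow>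
      count_series (\<lambda>t. card (dilate t (convex hull W) \<inter> integer_points)) s m * (1 - fps_X ^ m) ^ (CARD('d) + 1)
        = count_series p s m"
proof -
  have W0: "W \<noteq> {}" using W(3) by auto
  let ?V = "lift_points W"
  have V: "finite ?V" "span ?V = UNIV" "linear snd" "\<And>v. v \<in> ?V \<Longrightarrow> snd v = 1"
    using W span_lift_points by (auto simp: lift_points_def linear_snd)
  obtain T X where T: "finite T" "T \<subseteq> bases_within ?V" "\<forall>B\<in>T. X B \<subset> B"
    and cone: "nonneg_cone ?V = (\<Union>B\<in>T. half_open_box B (X B) B)"
    and disj: "disjoint_family_on (\<lambda>B. half_open_box B (X B) B) T"
    by (rule half_open_decomposition[OF V]) blast
  define p where "p = (\<lambda>s. \<Sum>B\<in>T. slice_count (half_open_box B (X B) {}) s)"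
  have count: "card (dilate s (convex hull W) \<inter> integer_points) =
      (\<Sum>B\<in>T. slice_count (half_open_box B (X B) B) s)" if "s \<ge> 0" for s
  proof -
    let ?N = "\<lambda>B. {y \<in> integer_points. (y, s) \<in> half_open_box B (X B) B}"
    have "dilate s (convex hull W) \<inter> integer_points = {y \<in> integer_points. (y, s) \<in> nonneg_cone ?V}"
      using nonneg_cone_lift_points[OF W(1) W0] that by blast
    also have "\<dots> = (\<Union>B\<in>T. ?N B)" unfolding cone by blast
    also have "card \<dots> = (\<Sum>B\<in>T. card (?N B))"
    proof (rule card_UN_disjoint[OF T(1)])
      show "\<forall>B\<in>T. finite (?N B)" using finite_cone_slice[OF W(1) W0] cone by blast
      show "\<forall>B\<in>T. \<forall>B'\<in>T. B \<noteq> B' \<longrightarrow> ?N B \<inter> ?N B' = {}"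
        using disj by (auto simp: disjoint_family_on_def)
    qed
    finally show ?thesis by (simp add: slice_count_def)
  qed
  show thesis
  proof (rule that[of p])
    show "p s = 0" if "s \<ge> real CARD('d) + 1" for s
      unfolding p_def
    proof (rule sum.neutral, rule ballI)
      fix B assume "B \<in> T"
      then show "slice_count (half_open_box B (X B) {}) s = 0"
        using slice_count_box_high[OF _ _ that, of B W "X B"] T(2,3) by auto
    qed
    fix m and s :: real assume ms: "m > 0" "0 \<le> s" "s < 1 / real m"
    have "count_series (\<lambda>t. card (dilate t (convex hull W) \<inter> integer_points)) s m =
        (\<Sum>B\<in>T. count_series (slice_count (half_open_box B (X B) B)) s m)"
      using ms by (intro fps_ext) (simp add: count_series_def fps_sum_nth count)
    then have "count_series (\<lambda>t. card (dilate t (convex hull W) \<inter> integer_points)) s m * (1 - fps_X ^ m) ^ (CARD('d) + 1)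
        = (\<Sum>B\<in>T. count_series (slice_count (half_open_box B (X B) B)) s m * (1 - fps_X ^ m) ^ (CARD('d) + 1))"
      by (simp only: sum_distrib_right)
    also have "\<dots> = (\<Sum>B\<in>T. count_series (slice_count (half_open_box B (X B) {})) s m)"
      using count_series_half_open_cone[OF W(1) W0 W(2) _ ms(1,3)] T(2) by (intro sum.cong) auto
    also have "\<dots> = count_series p s m"
      by (intro fps_ext) (simp add: count_series_def fps_sum_nth p_def)
    finally show "count_series (\<lambda>t. card (dilate t (convex hull W) \<inter> integer_points)) s m * (1 - fps_X ^ m) ^ (CARD('d) + 1)
        = count_series p s m" .
  qed
qed

section \<open>From the generating function to a quasipolynomial\<close>
lemma negative_binomial_series:
  "(1 - fps_X) ^ (d + 1) * Abs_fps (\<lambda>k. of_nat ((k + d) choose d)) = (1 :: rat fps)"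
proof (induction d)
  case 0
  show ?case
    by (rule fps_ext) (auto simp: left_diff_distrib)
next
  case (Suc d)
  have "(1 - fps_X) * Abs_fps (\<lambda>k. of_nat ((k + Suc d) choose Suc d)) =
      (Abs_fps (\<lambda>k. of_nat ((k + d) choose d)) :: rat fps)"
  proof (rule fps_ext)
    fix n
    show "fps_nth ((1 - fps_X) * Abs_fps (\<lambda>k. of_nat ((k + Suc d) choose Suc d))) n =
      (fps_nth (Abs_fps (\<lambda>k. of_nat ((k + d) choose d))) n :: rat)"
      by (cases n) (simp_all add: left_diff_distrib)
  qed
  moreover have "(1 - fps_X) ^ (Suc d + 1) * Abs_fps (\<lambda>k. of_nat ((k + Suc d) choose Suc d)) =
      (1 - fps_X) ^ (d + 1) * ((1 - fps_X) * Abs_fps (\<lambda>k. of_nat ((k + Suc d) choose Suc d)) :: rat fps)"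
    by (simp only: add_Suc power_Suc2 mult.assoc)
  ultimately show ?case using Suc by (simp only:)
qed

text \<open>
  The upper limit of the sum is \<open>d\<close> for all \<open>k\<close>, also for \<open>k < d\<close>: the terms with \<open>k < i \<le> d\<close> vanish because then
  \<open>k + d - i < d\<close>. This is where vanishing of \<open>p\<close> at height \<open>d + 1\<close> matters, and it gives a formula that is
  polynomial in \<open>k\<close> from \<open>k = 0\<close> on.
\<close>
lemma count_eq_binomial_sum:
  assumes series: "count_series f s 1 * (1 - fps_X ^ 1) ^ (d + 1) = count_series p s 1"
    and s: "0 \<le> s" and p: "\<And>t. t \<ge> real d + 1 \<Longrightarrow> p t = 0"
  shows "of_nat (f (s + real k)) = (\<Sum>i\<le>d. of_nat (p (s + real i)) * (of_nat ((k + d - i) choose d) :: rat))"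
proof -
  let ?S = "Abs_fps (\<lambda>k. of_nat ((k + d) choose d)) :: rat fps"
  have "count_series f s 1 = count_series f s 1 * ((1 - fps_X) ^ (d + 1) * ?S)"
    by (simp only: negative_binomial_series mult_1_right)
  also have "\<dots> = count_series p s 1 * ?S"
    using series by (simp only: mult.assoc[symmetric] power_one_right)
  finally have eq: "count_series f s 1 = count_series p s 1 * ?S" .
  have "of_nat (f (s + real k)) = fps_nth (count_series f s 1) k" by (simp add: count_series_def)
  also have "\<dots> = (\<Sum>i=0..k. of_nat (p (s + real i)) * of_nat ((k - i + d) choose d))"
    unfolding eq fps_mult_nth by (simp add: count_series_def)
  also have "\<dots> = (\<Sum>i\<in>{0..k} \<inter> {..d}. of_nat (p (s + real i)) * of_nat ((k - i + d) choose d))"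
    using s p by (intro sum.mono_neutral_right) auto
  also have "\<dots> = (\<Sum>i\<le>d. of_nat (p (s + real i)) * of_nat ((k + d - i) choose d))"
    by (intro sum.mono_neutral_cong_left) auto
  finally show ?thesis .
qed

text \<open>
  Write \<open>l * \<rho> = frac (l * \<rho>) + k\<close>. The binomial sum is a polynomial in \<open>k\<close>, hence in \<open>l\<close>, whose coefficients depend on
  \<open>l\<close> through \<open>frac (l * \<rho>)\<close> only.
\<close>
theorem quasipolynomial_of_series:
  fixes \<rho> :: rat and f :: "rat \<Rightarrow> nat"
  assumes \<rho>: "\<rho> > 0" and f: "\<And>l. 0 \<le> l \<Longrightarrow> f l = F (real_of_rat (l * \<rho>))"
    and series: "\<And>s. 0 \<le> s \<Longrightarrow> s < 1 \<Longrightarrow> count_series F s 1 * (1 - fps_X ^ 1) ^ (d + 1) = count_series p s 1"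
    and p: "\<And>t. t \<ge> real d + 1 \<Longrightarrow> p t = 0"
  obtains c where "quasipolynomial_coeffs d c (\<lambda>l. of_nat (f l))" "\<And>i. is_period (1 / \<rho>) (c i)"
proof -
  \<comment> \<open>The factor at \<open>j\<close> takes the value \<open>k + d - i - j\<close> at \<open>l\<close>, so the product over \<open>fact d\<close> is the binomial coefficient.\<close>
  define q where "q = (\<lambda>l. \<Sum>i\<le>d. smult (of_nat (p (real_of_rat (frac (l * \<rho>)) + real i)) / fact d)
      (\<Prod>j<d. [:of_nat d - of_nat i - of_nat j - frac (l * \<rho>), \<rho>:]))"
  define c where "c = (\<lambda>i l. coeff (q l) i)"
  have deg: "degree (q l) \<le> d" for l
    unfolding q_def
  proof (intro degree_sum_le finite_atMost order_trans[OF degree_smult_le])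
    fix i
    have "degree (\<Prod>j<d. [:of_nat d - of_nat i - of_nat j - frac (l * \<rho>), \<rho>:]) \<le>
        (\<Sum>j<d. degree [:of_nat d - of_nat i - of_nat j - frac (l * \<rho>), \<rho>:])"
      by (intro degree_prod_sum_le[of "{..<d}", unfolded o_def]) simp
    also have "\<dots> \<le> (\<Sum>j<d. 1)" by (intro sum_mono) auto
    finally show "degree (\<Prod>j<d. [:of_nat d - of_nat i - of_nat j - frac (l * \<rho>), \<rho>:]) \<le> d" by simp
  qed
  have val: "of_nat (f l) = poly (q l) l" if l: "0 \<le> l" for l
  proof -
    define x where "x = frac (l * \<rho>)"
    define k where "k = nat \<lfloor>l * \<rho>\<rfloor>"
    have k: "l * \<rho> = x + of_nat k" using l \<rho> by (simp add: x_def k_def frac_def)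
    have x: "0 \<le> x" "x < 1" by (auto simp: x_def frac_ge_0 frac_lt_1)
    then have rx: "0 \<le> real_of_rat x" "real_of_rat x < 1" by auto
    have "of_nat (f l) = (of_nat (F (real_of_rat x + real k)) :: rat)"
      using f[OF l] by (simp add: k of_rat_add)
    also have "\<dots> = (\<Sum>i\<le>d. of_nat (p (real_of_rat x + real i)) * of_nat ((k + d - i) choose d))"
      by (rule count_eq_binomial_sum[OF series[OF rx] rx(1) p])
    also have "\<dots> = poly (q l) l"
      unfolding q_def poly_sum x_def[symmetric]
    proof (rule sum.cong[OF refl])
      fix i assume "i \<in> {..d}"
      then have "(of_nat (k + d - i) :: rat) = of_nat k + of_nat d - of_nat i" by (simp add: of_nat_diff)
      then have "(of_nat ((k + d - i) choose d) :: rat) =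
          (\<Prod>j<d. of_nat k + of_nat d - of_nat i - of_nat j) / fact d"
        by (simp add: binomial_gbinomial gbinomial_prod_rev atLeast0LessThan)
      also have "(\<Prod>j<d. of_nat k + of_nat d - of_nat i - of_nat j) =
          (\<Prod>j<d. poly [:of_nat d - of_nat i - of_nat j - x, \<rho>:] l)"
        using k by (intro prod.cong) (auto simp: algebra_simps)
      finally show "of_nat (p (real_of_rat x + real i)) * of_nat ((k + d - i) choose d) =
          poly (smult (of_nat (p (real_of_rat x + real i)) / fact d)
            (\<Prod>j<d. [:of_nat d - of_nat i - of_nat j - x, \<rho>:])) l"
        by (simp add: poly_prod)
    qed
    finally show ?thesis .
  qed
  have "q (l + 1 / \<rho>) = q l" for l
  proof -
    have "frac ((l + 1 / \<rho>) * \<rho>) = frac (l * \<rho>)"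
      using \<rho> by (simp add: distrib_right frac_def)
    then show ?thesis by (simp add: q_def)
  qed
  then have per: "is_period (1 / \<rho>) (c i)" for i
    using \<rho> by (simp add: is_period_def c_def)
  have "poly (q l) l = (\<Sum>i\<le>d. c i l * l ^ i)" for l
    unfolding poly_altdef c_def using deg[of l]
    by (intro sum.mono_neutral_left) (auto simp: coeff_eq_0)
  then have "quasipolynomial_coeffs d c (\<lambda>l. of_nat (f l))"
    using val per by (auto simp: quasipolynomial_coeffs_def)
  then show thesis using per by (rule that)
qed

lemma is_period_add_multiple: "is_period p c \<Longrightarrow> c (x + of_nat k * p) = c x"
proof (induction k)
  case (Suc k)
  have "x + of_nat (Suc k) * p = (x + of_nat k * p) + p" by (simp add: algebra_simps)
  then show ?case using Suc unfolding is_period_def by metis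
qed simp

lemma is_period_multiple: "is_period p c \<Longrightarrow> 0 < k \<Longrightarrow> is_period (of_nat k * p) c"
  using is_period_add_multiple[of p c] by (auto simp: is_period_def)

text \<open>
  The numerator of a positive rational period is itself a period, so the product of the numerators is a common one.
\<close>
lemma common_period:
  assumes "finite I" "\<And>i. i \<in> I \<Longrightarrow> \<exists>p. is_period p (c i)"
  shows "\<exists>N>0. \<forall>i\<in>I. is_period (of_nat N) (c i)"
  using assms
proof (induction I rule: finite_induct)
  case (insert i I)
  then obtain N where N: "N > 0" "\<forall>i\<in>I. is_period (of_nat N) (c i)" by auto
  obtain p where p: "is_period p (c i)" using insert.prems by blast
  obtain a b where ab: "quotient_of p = (a, b)" by (cases "quotient_of p") auto
  have b: "b > 0" and pab: "p = of_int a / of_int b"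
    using quotient_of_denom_pos[OF ab] quotient_of_div[OF ab] by auto
  have a: "a > 0" using p b by (auto simp: is_period_def pab zero_less_divide_iff)
  have "of_nat (nat b) * p = of_nat (nat a)" using a b pab by simp
  then have "is_period (of_nat (nat a)) (c i)"
    using is_period_multiple[OF p, of "nat b"] b by simp
  then have "is_period (of_nat (N * nat a)) (c i)"
    using is_period_multiple[of _ "c i" N] N(1) by simp
  moreover have "is_period (of_nat (N * nat a)) (c j)" if "j \<in> I" for j
    using is_period_multiple[of "of_nat N" "c j" "nat a"] N(2) that a by (simp add: mult.commute)
  ultimately show ?case using N(1) a by (intro exI[of _ "N * nat a"]) auto
qed (auto intro: exI[of _ 1])

lemma poly_eq_on_progression:
  fixes A B :: "rat poly"
  assumes "p > 0" "\<And>k::nat. k \<ge> K \<Longrightarrow> poly A (x + of_nat k * p) = poly B (x + of_nat k * p)"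
  shows "A = B"
proof (rule ccontr)
  assume "A \<noteq> B"
  then have "finite {y. poly (A - B) y = 0}" by (intro poly_roots_finite) simp
  moreover have "(\<lambda>k. x + of_nat k * p) ` {K..} \<subseteq> {y. poly (A - B) y = 0}" using assms(2) by auto
  ultimately have "finite ((\<lambda>k. x + of_nat k * p) ` {K..})" by (rule finite_subset[rotated])
  moreover have "inj_on (\<lambda>k::nat. x + of_nat k * p) {K..}" using assms(1) by (auto simp: inj_on_def)
  ultimately show False using finite_imageD infinite_Ici by blast
qed

section \<open>Uniqueness of the coefficients\<close>

text \<open>
  The polynomial with which the quasipolynomial agrees on the residue class of \<open>x\<close> modulo a common period.
\<close>
definition local_poly :: "nat \<Rightarrow> (nat \<Rightarrow> rat \<Rightarrow> rat) \<Rightarrow> rat \<Rightarrow> rat poly" where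
  "local_poly d c x = (\<Sum>i\<le>d. monom (c i x) i)"

lemma poly_local_poly: "poly (local_poly d c x) l = (\<Sum>i\<le>d. c i x * l ^ i)"
  by (simp add: local_poly_def poly_sum poly_monom)

lemma coeff_local_poly: "i \<le> d \<Longrightarrow> coeff (local_poly d c x) i = c i x"
  by (simp add: local_poly_def coeff_sum if_distrib cong: if_cong)

lemma quasipolynomial_eq_local_poly:
  assumes "quasipolynomial_coeffs d c f" "\<And>i. i \<le> d \<Longrightarrow> is_period p (c i)" "0 \<le> x + of_nat k * p"
  shows "f (x + of_nat k * p) = poly (local_poly d c x) (x + of_nat k * p)"
  using assms(1,3) is_period_add_multiple[OF assms(2)]
  by (simp add: quasipolynomial_coeffs_def poly_local_poly)

lemma exists_shift_nonneg:
  fixes p x :: rat assumes "p > 0"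
  shows "\<exists>K. \<forall>k\<ge>K. 0 \<le> x + of_nat k * p"
proof -
  obtain K where K: "- x < of_nat K * p" using ex_less_of_nat_mult[OF assms] by blast
  have "0 \<le> x + of_nat k * p" if "k \<ge> K" for k
  proof -
    have "of_nat K * p \<le> of_nat k * p" using that assms by (intro mult_right_mono) auto
    then show ?thesis using K by linarith
  qed
  then show ?thesis by blast
qed

theorem quasipolynomial_coeffs_unique:
  assumes c: "quasipolynomial_coeffs d c f" and c': "quasipolynomial_coeffs d c' f" and i: "i \<le> d"
  shows "c i x = c' i x"
proof -
  obtain N where N: "N > 0" "\<forall>i\<in>{..d}. is_period (of_nat N) (c i)"
    using common_period[of "{..d}" c] c by (auto simp: quasipolynomial_coeffs_def)
  obtain N' where N': "N' > 0" "\<forall>i\<in>{..d}. is_period (of_nat N') (c' i)"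
    using common_period[of "{..d}" c'] c' by (auto simp: quasipolynomial_coeffs_def)
  define p :: rat where "p = of_nat N * of_nat N'"
  have p: "p > 0" using N N' by (simp add: p_def)
  have per: "is_period p (c j)" "is_period p (c' j)" if "j \<le> d" for j
    using is_period_multiple[of "of_nat N" "c j" N'] is_period_multiple[of "of_nat N'" "c' j" N] N N' that
    by (auto simp: p_def mult.commute)
  obtain K where K: "\<forall>k\<ge>K. 0 \<le> x + of_nat k * p" using exists_shift_nonneg[OF p] by blast
  have "local_poly d c x = local_poly d c' x"
  proof (rule poly_eq_on_progression[OF p, of K _ x])
    fix k assume "k \<ge> K"
    then have nonneg: "0 \<le> x + of_nat k * p" using K by blast
    show "poly (local_poly d c x) (x + of_nat k * p) = poly (local_poly d c' x) (x + of_nat k * p)"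
      using quasipolynomial_eq_local_poly[OF c per(1) nonneg] quasipolynomial_eq_local_poly[OF c' per(2) nonneg]
      by simp
  qed
  then show ?thesis using coeff_local_poly[OF i] by metis
qed

section \<open>Periods are multiples of the grid size\<close>

text \<open>
  A quasipolynomial that is constant on the open intervals between consecutive multiples of \<open>1/r\<close> has
  the same values along the progressions starting at two points \<open>x\<close> and \<open>y\<close> of one interval, since \<open>m/r\<close>
  carries intervals to intervals. The polynomials that express these values in terms of the
  displacement from the starting point therefore coincide.
\<close>
lemma local_poly_shift_eq:
  fixes f :: "rat \<Rightarrow> rat" and r m :: nat
  assumes c: "quasipolynomial_coeffs d c f" and r: "r > 0"
    and per: "\<And>i. i \<le> d \<Longrightarrow> is_period (of_nat m / of_nat r) (c i)"
    and const: "\<And>n l l'. of_nat n < l * of_nat r \<Longrightarrow> l * of_nat r < of_nat n + 1 \<Longrightarrow>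
      of_nat n < l' * of_nat r \<Longrightarrow> l' * of_nat r < of_nat n + 1 \<Longrightarrow> f l = f l'"
    and x: "of_int n < x * of_nat r" "x * of_nat r < of_int n + 1"
    and y: "of_int n < y * of_nat r" "y * of_nat r < of_int n + 1"
  shows "poly (local_poly d c x) (x + l) = poly (local_poly d c y) (y + l)"
proof -
  define p :: rat where "p = of_nat m / of_nat r"
  have p: "p > 0" using per[of 0] by (simp add: is_period_def p_def)
  then have m: "m > 0" by (simp add: p_def zero_less_divide_iff)
  obtain K1 where K1: "\<forall>k\<ge>K1. 0 \<le> x + of_nat k * p" using exists_shift_nonneg[OF p] by blast
  obtain K2 where K2: "\<forall>k\<ge>K2. 0 \<le> y + of_nat k * p" using exists_shift_nonneg[OF p] by blast
  \<comment> \<open>The local polynomials, re-expanded around their own base points.\<close>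
  define H where "H = (\<lambda>x. pcompose (local_poly d c x) [:x, 1:])"
  have "H x = H y"
  proof (rule poly_eq_on_progression[OF p, of "max (max K1 K2) (nat \<bar>n\<bar>)" _ 0])
    fix k assume k: "k \<ge> max (max K1 K2) (nat \<bar>n\<bar>)"
    \<comment> \<open>The index of the interval that contains both shifted points; the bound on \<open>k\<close> makes it nonnegative.\<close>
    define N where "N = nat (n + int k * int m)"
    have "int k \<le> int k * int m" using m by (simp add: mult_le_cancel_left1)
    then have "n + int k * int m \<ge> 0" using k by linarith
    then have "int N = n + int k * int m" by (simp add: N_def)
    then have "(of_int (int N) :: rat) = of_int (n + int k * int m)" by (simp only:)
    then have N: "(of_nat N :: rat) = of_int n + of_nat k * of_nat m" by simp
    have sh: "(z + of_nat k * p) * of_nat r = z * of_nat r + of_nat k * of_nat m" for z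
      using r by (simp add: p_def field_simps)
    have "f (x + of_nat k * p) = f (y + of_nat k * p)"
      using x y by (intro const[of N]) (auto simp: sh N)
    then show "poly (H x) (0 + of_nat k * p) = poly (H y) (0 + of_nat k * p)"
      using quasipolynomial_eq_local_poly[OF c per, of x k] quasipolynomial_eq_local_poly[OF c per, of y k] K1 K2 k
      by (simp add: H_def poly_pcompose flip: p_def)
  qed
  then have "poly (H x) l = poly (H y) l" by simp
  then show ?thesis by (simp add: H_def poly_pcompose)
qed

text \<open>
  Let \<open>h x l\<close> be the value at displacement \<open>l\<close> from \<open>x\<close> of the polynomial attached to \<open>x\<close>. As a function of \<open>x\<close>
  it is constant between grid points. A period \<open>q\<close> that is not a multiple of \<open>1/r\<close> moves every grid point
  into the interior of an interval, so \<open>h\<close> is locally constant at grid points too. Then \<open>h\<close> does not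
  depend on \<open>x\<close> at all, and \<open>f x = h x 0\<close> is constant on nonnegative arguments.
\<close>
theorem common_period_multiple:
  fixes f :: "rat \<Rightarrow> rat" and r m :: nat
  assumes c: "quasipolynomial_coeffs d c f" and r: "r > 0"
    and per: "\<And>i. i \<le> d \<Longrightarrow> is_period (of_nat m / of_nat r) (c i)"
    and const: "\<And>n l l'. of_nat n < l * of_nat r \<Longrightarrow> l * of_nat r < of_nat n + 1 \<Longrightarrow>
      of_nat n < l' * of_nat r \<Longrightarrow> l' * of_nat r < of_nat n + 1 \<Longrightarrow> f l = f l'"
    and nonconst: "0 \<le> t" "f t \<noteq> f 0"
    and q: "\<And>i. i \<le> d \<Longrightarrow> is_period q (c i)"
  shows "q * of_nat r \<in> \<int>"
proof (rule ccontr)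
  assume notint: "q * of_nat r \<notin> \<int>"
  define h where "h = (\<lambda>x l. poly (local_poly d c x) (x + l))"
  have h_grid: "h x l = h y l" if "of_int n < x * of_nat r" "x * of_nat r < of_int n + 1"
    "of_int n < y * of_nat r" "y * of_nat r < of_int n + 1" for n x y l
    unfolding h_def by (rule local_poly_shift_eq[OF c r per const that])
  have h_period: "h x l = h (x + q) (l - q)" for x l
    using q by (simp add: h_def poly_local_poly is_period_def)
  define \<phi> where "\<phi> = frac (q * of_nat r)"
  have \<phi>: "0 < \<phi>" "\<phi> < 1" using notint by (auto simp: \<phi>_def frac_gt_0_iff frac_lt_1)
  define \<delta> where "\<delta> = min \<phi> (1 - \<phi>)"
  have \<delta>: "0 < \<delta>" "\<delta> \<le> \<phi>" "\<delta> \<le> 1 - \<phi>" using \<phi> by (auto simp: \<delta>_def)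
  have near: "h ((of_int n + z) / of_nat r) l = h (of_int n / of_nat r) l" if z: "\<bar>z\<bar> < \<delta>" for n z l
  proof -
    have qr: "q * of_nat r = of_int \<lfloor>q * of_nat r\<rfloor> + \<phi>" by (simp add: \<phi>_def frac_def)
    have e: "((of_int n + z) / of_nat r + q) * of_nat r = of_int (n + \<lfloor>q * of_nat r\<rfloor>) + (\<phi> + z)" for z
    proof -
      have "((of_int n + z) / of_nat r + q) * of_nat r = of_int n + z + q * of_nat r"
        using r by (simp add: field_simps)
      then show ?thesis using qr by simp
    qed
    have "\<phi> + z > 0" "\<phi> + z < 1" using z \<delta> by auto
    then have "h ((of_int n + z) / of_nat r + q) (l - q) = h ((of_int n + 0) / of_nat r + q) (l - q)"
      using \<phi> by (intro h_grid[of "n + \<lfloor>q * of_nat r\<rfloor>"]) (unfold e, linarith+)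
    then show ?thesis by (simp add: h_period[symmetric])
  qed
  have left: "h x l = h (of_int n / of_nat r) l"
    if "of_int n < x * of_nat r" "x * of_nat r < of_int n + 1" for x n l
  proof -
    have "h x l = h ((of_int n + \<delta> / 2) / of_nat r) l"
      using that r \<delta> \<phi> by (intro h_grid[of n]) auto
    also have "\<dots> = h (of_int n / of_nat r) l" using \<delta> by (intro near) auto
    finally show ?thesis .
  qed
  have step: "h (of_int (n + 1) / of_nat r) l = h (of_int n / of_nat r) l" for n l
  proof -
    have "h (of_int (n + 1) / of_nat r) l = h ((of_int (n + 1) + - (\<delta> / 2)) / of_nat r) l"
      using \<delta> by (intro near[symmetric]) auto
    also have "\<dots> = h (of_int n / of_nat r) l"
      using r \<delta> \<phi> by (intro left) auto
    finally show ?thesis .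
  qed
  have grid: "h (of_nat n / of_nat r) l = h 0 l" for n l
  proof (induction n)
    case (Suc n)
    then show ?case using step[of "int n" l] by (simp add: add.commute)
  qed simp
  define n where "n = \<lfloor>t * of_nat r\<rfloor>"
  have n: "of_int n \<le> t * of_nat r" "t * of_nat r < of_int n + 1" "0 \<le> n"
    using nonconst(1) floor_correct[of "t * of_nat r"] by (auto simp: n_def)
  have "h t 0 = h (of_int n / of_nat r) 0"
  proof (cases "of_int n = t * of_nat r")
    case True
    then show ?thesis using r by simp
  qed (use n left in auto)
  also have "\<dots> = h 0 0" using grid[of "nat n"] n(3) by simp
  finally have "h t 0 = h 0 0" .
  moreover have "f x = h x 0" if "0 \<le> x" for x
    using quasipolynomial_eq_local_poly[OF c per, of x 0] that by (simp add: h_def)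
  ultimately show False using nonconst by simp
qed

text \<open>
  The numbers \<open>j\<close> for which \<open>j/r\<close> is a common period are closed under taking remainders, so the least
  positive one divides \<open>m\<close>.
\<close>
lemma exists_least_common_period:
  assumes r: "r > 0" and m: "m > 0"
    and per: "\<And>i. i \<le> d \<Longrightarrow> is_period (of_nat m / of_nat r) (c i)"
    and mult: "\<And>q. (\<And>i. i \<le> d \<Longrightarrow> is_period q (c i)) \<Longrightarrow> q * of_nat r \<in> \<int>"
  shows "\<exists>j. j dvd m \<and> least_common_period d c (of_nat j / of_nat r)"
proof -
  define G where "G = (\<lambda>j. j > 0 \<and> (\<forall>i\<le>d. is_period (of_nat j / of_nat r) (c i)))"
  have "G m" using m per by (simp add: G_def)
  define j where "j = (LEAST j. G j)"
  have j: "G j" unfolding j_def using \<open>G m\<close> by (rule LeastI)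
  have least: "j \<le> k" if "G k" for k unfolding j_def using that by (rule Least_le)
  have "m mod j = 0"
  proof (rule ccontr)
    assume nz: "m mod j \<noteq> 0"
    have "is_period (of_nat (m mod j) / of_nat r) (c i)" if i: "i \<le> d" for i
    proof -
      have "c i (x + of_nat (m mod j) / of_nat r) = c i x" for x
      proof -
        have jp: "is_period (of_nat j / of_nat r) (c i)" using j i by (simp add: G_def)
        have "(of_nat m :: rat) = of_nat (m mod j + (m div j) * j)" by simp
        then have "(of_nat m :: rat) = of_nat (m mod j) + of_nat (m div j) * of_nat j"
          by (simp only: of_nat_add of_nat_mult)
        then have "x + of_nat m / of_nat r =
            x + of_nat (m mod j) / of_nat r + of_nat (m div j) * (of_nat j / of_nat r)"
          by (simp add: add_divide_distrib)
        moreover have "c i (x + of_nat m / of_nat r) = c i x" using per[OF i] by (simp add: is_period_def)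
        ultimately show ?thesis
          using is_period_add_multiple[OF jp, of "x + of_nat (m mod j) / of_nat r" "m div j"] by metis
      qed
      then show ?thesis using nz r by (simp add: is_period_def)
    qed
    then have "G (m mod j)" using nz by (simp add: G_def)
    moreover have "m mod j < j" using j by (simp add: G_def)
    ultimately show False using least[of "m mod j"] by simp
  qed
  moreover have "least_common_period d c (of_nat j / of_nat r)"
    unfolding least_common_period_def
  proof (intro conjI allI impI)
    fix q assume q: "\<forall>i\<le>d. is_period q (c i)"
    obtain k where k: "q * of_nat r = of_int k" using mult[of q] q by (auto elim: Ints_cases)
    have "q > 0" using q by (auto simp: is_period_def)
    then have "(0 :: rat) < of_int k" using r by (simp flip: k)
    then have k0: "k > 0" by simp
    have qk: "q = of_nat (nat k) / of_nat r" using k k0 r by (simp add: field_simps)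
    then have "G (nat k)" using q k0 by (simp add: G_def)
    then have "j \<le> nat k" by (rule least)
    then show "of_nat j / of_nat r \<le> q" unfolding qk by (intro divide_right_mono) auto
  qed (use j in \<open>auto simp: G_def\<close>)
  ultimately show ?thesis by (intro exI[of _ j]) auto
qed

section \<open>The role of the codenominator\<close>

text \<open>
  As a function of \<open>l\<close>, the inequality \<open>k \<le> l * b\<close> changes its truth value at \<open>k/b\<close> only, which is a multiple of \<open>1/r\<close>
  when \<open>b\<close> divides \<open>r\<close>.
\<close>
lemma int_le_scaled_bound:
  fixes k b :: int and l l' :: rat and n r :: nat
  assumes l: "of_nat n < l * of_nat r" "l * of_nat r < of_nat n + 1"
    and l': "of_nat n < l' * of_nat r" "l' * of_nat r < of_nat n + 1"
    and b: "b = 0 \<or> b dvd int r" and k: "of_int k \<le> l * of_int b" and r: "r > 0"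
  shows "of_int k \<le> l' * of_int b"
proof (cases "b = 0")
  case False
  then obtain e where e: "int r = b * e" using b by (auto elim: dvdE)
  then have re: "(of_nat r :: rat) = of_int b * of_int e" by (metis of_int_mult of_int_of_nat_eq)
  have "e \<noteq> 0" using e r by auto
  show ?thesis
  proof (cases "e > 0")
    case True
    have "of_int (k * e) \<le> l * of_nat r"
      using mult_right_mono[OF k, of "of_int e"] True by (simp add: re mult.assoc)
    then have "(of_int (k * e) :: rat) < of_int (int n + 1)" using l by simp
    then have "k * e \<le> int n" by linarith
    then have "(of_int (k * e) :: rat) \<le> of_int (int n)" by (simp only: of_int_le_iff)
    then have "of_int k * of_int e \<le> (l' * of_int b) * (of_int e :: rat)" using l' by (simp add: re mult.assoc)
    then show ?thesis using True by simp
  next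
    case False
    then have e0: "e < 0" using \<open>e \<noteq> 0\<close> by simp
    have "of_int (k * e) \<ge> l * of_nat r"
      using mult_right_mono_neg[OF k, of "of_int e"] e0 by (simp add: re mult.assoc)
    then have "(of_int (k * e) :: rat) > of_int (int n)" using l by simp
    then have "k * e \<ge> int n + 1" by linarith
    then have "(of_int (k * e) :: rat) \<ge> of_int (int n + 1)" by (simp only: of_int_le_iff)
    then have "of_int k * of_int e \<ge> (l' * of_int b) * (of_int e :: rat)" using l' by (simp add: re mult.assoc)
    then show ?thesis using e0 by (simp add: mult_le_cancel_right)
  qed
qed (use k in simp)

lemma codenominator_pos:
  assumes "is_codenominator P r"
  shows "r > 0"
proof -
  obtain n A b where "irredundant_description P n A b" and r: "int r = Lcm {b i | i. i < n \<and> b i \<noteq> 0}"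
    using assms unfolding is_codenominator_def by blast
  have "finite {b i | i. i < n \<and> b i \<noteq> 0}" by simp
  then have "Lcm {b i | i. i < n \<and> b i \<noteq> 0} \<noteq> 0" by (subst Lcm_0_iff) auto
  then show ?thesis using r by simp
qed

lemma mem_dilate_iff: "s \<noteq> 0 \<Longrightarrow> x \<in> dilate s P \<longleftrightarrow> (1 / s) *\<^sub>R x \<in> P"
  by (force simp: dilate_def)

lemma dilate_dilate: "dilate s (dilate t P) = dilate (s * t) P"
  by (auto simp: dilate_def image_image)

text \<open>
  At a lattice point the left-hand sides of the defining inequalities are integers, so membership in the
  dilate changes only at multiples of \<open>1/r\<close>.
\<close>
theorem ehr_constant_between:
  fixes P :: "(real ^ 'd) set" and l l' :: rat
  assumes codenom: "is_codenominator P r"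
    and l: "of_nat n < l * of_nat r" "l * of_nat r < of_nat n + 1"
    and l': "of_nat n < l' * of_nat r" "l' * of_nat r < of_nat n + 1"
  shows "ehr P l = ehr P l'"
proof -
  have r: "r > 0" by (rule codenominator_pos[OF codenom])
  obtain N A b where desc: "irredundant_description P N A b"
    and lcm: "int r = Lcm {b i | i. i < N \<and> b i \<noteq> 0}"
    using codenom unfolding is_codenominator_def by blast
  have P: "P = {x. \<forall>i<N. (\<Sum>k\<in>UNIV. real_of_int (A i $ k) * x $ k) \<le> real_of_int (b i)}"
    using desc by (auto simp: irredundant_description_def halfspace_intersection_def)
  have b: "b i = 0 \<or> b i dvd int r" if "i < N" for i
    unfolding lcm using that by (auto intro!: dvd_Lcm)
  have mono: "dilate (real_of_rat u) P \<inter> integer_points \<subseteq> dilate (real_of_rat v) P"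
    if u: "of_nat n < u * of_nat r" "u * of_nat r < of_nat n + 1"
      and v: "of_nat n < v * of_nat r" "v * of_nat r < of_nat n + 1" for u v
  proof
    fix x assume x: "x \<in> dilate (real_of_rat u) P \<inter> integer_points"
    have "0 < u * of_nat r" "0 < v * of_nat r"
      using u(1) v(1) of_nat_0_le_iff[of n] by (auto intro: order.strict_trans1)
    then have pos: "u > 0" "v > 0" using r by (auto simp: zero_less_mult_iff)
    have dil: "x \<in> dilate (real_of_rat w) P \<longleftrightarrow>
        (\<forall>i<N. (\<Sum>k\<in>UNIV. real_of_int (A i $ k) * x $ k) \<le> real_of_rat w * real_of_int (b i))"
      if "w > 0" for w :: rat
    proof -
      have "(\<Sum>k\<in>UNIV. real_of_int (A i $ k) * ((1 / real_of_rat w) *\<^sub>R x) $ k) =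
          (\<Sum>k\<in>UNIV. real_of_int (A i $ k) * x $ k) / real_of_rat w" for i
        by (simp add: sum_divide_distrib)
      then show ?thesis
        using that by (subst mem_dilate_iff) (auto simp: P pos_divide_le_eq mult.commute)
    qed
    show "x \<in> dilate (real_of_rat v) P"
      unfolding dil[OF pos(2)]
    proof (intro allI impI)
      fix i assume i: "i < N"
      have "(\<Sum>k\<in>UNIV. real_of_int (A i $ k) * x $ k) \<in> \<int>"
        using x by (intro Ints_sum Ints_mult) (auto simp: integer_points_def)
      then obtain k where k: "(\<Sum>k\<in>UNIV. real_of_int (A i $ k) * x $ k) = of_int k" by (auto elim: Ints_cases)
      have "(of_int k :: real) \<le> real_of_rat u * real_of_int (b i)"
        using x i dil[OF pos(1)] by (simp flip: k)
      then have "real_of_rat (of_int k) \<le> real_of_rat (u * of_int (b i))" by (simp add: of_rat_mult)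
      then have "of_int k \<le> u * of_int (b i)" by (simp only: of_rat_less_eq)
      then have "of_int k \<le> v * of_int (b i)" by (rule int_le_scaled_bound[OF u v b[OF i] _ r])
      then have "real_of_rat (of_int k) \<le> real_of_rat (v * of_int (b i))" by (simp only: of_rat_less_eq)
      then show "(\<Sum>k\<in>UNIV. real_of_int (A i $ k) * x $ k) \<le> real_of_rat v * real_of_int (b i)"
        unfolding k by (simp add: of_rat_mult)
    qed
  qed
  have "dilate (real_of_rat l) P \<inter> integer_points = dilate (real_of_rat l') P \<inter> integer_points"
    using mono[OF l l'] mono[OF l' l] by blast
  then show ?thesis by (simp add: ehr_def)
qed

section \<open>The rational Ehrhart theorem\<close>
lemma ehr_0: "P \<noteq> {} \<Longrightarrow> ehr P 0 = 1"
proof -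
  assume "P \<noteq> {}"
  then have "dilate 0 P \<inter> integer_points = {0}" by (auto simp: dilate_def integer_points_def)
  then show ?thesis by (simp add: ehr_def)
qed

theorem theorem6:
  fixes P :: "(real ^ 'd) set" and r m :: nat
  assumes "rational_polytope P"
    and "aff_dim P = int CARD('d)"
    and "is_codenominator P r"
    and "m > 0"
    and "lattice_polytope (dilate (real m / real r) P)"
  shows "(\<exists>h :: int poly. (\<forall>i. coeff h i \<ge> 0) \<and>
            ehrhart_series P r =
              fps_of_poly (map_poly of_int h) / (1 - fps_X ^ m) ^ (CARD('d) + 1)) \<and>
         quasipolynomial CARD('d) (\<lambda>l. of_nat (ehr P l)) \<and>
         (\<forall>c. quasipolynomial_coeffs CARD('d) c (\<lambda>l. of_nat (ehr P l)) \<longrightarrow>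
            (\<exists>j. j dvd m \<and> least_common_period CARD('d) c (of_nat j / of_nat r)))"
proof -
  let ?d = "CARD('d)"
  have r: "r > 0" by (rule codenominator_pos[OF assms(3)])
  have m: "m > 0" by (rule assms(4))
  have P: "P \<noteq> {}" using assms(2) by auto
  obtain W where W: "finite W" "W \<subseteq> integer_points" and hull: "dilate (real m / real r) P = convex hull W"
    using assms(5) by (auto simp: lattice_polytope_def)
  have "aff_dim (dilate (real m / real r) P) = aff_dim P"
    unfolding dilate_def using r m by (intro aff_dim_injective_linear_image linear_scale_self) (auto simp: inj_on_def)
  then have dimW: "aff_dim W = int ?d"
    using assms(2) by (simp add: hull aff_dim_convex_hull)
  then have aff: "affine hull W = UNIV" using aff_dim_eq_full[of W] by simp
  define F where "F = (\<lambda>t. card (dilate t (convex hull W) \<inter> integer_points))"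
  obtain p where p: "\<And>s. s \<ge> real ?d + 1 \<Longrightarrow> p s = 0"
    and series: "\<And>m s. m > 0 \<Longrightarrow> 0 \<le> s \<Longrightarrow> s < 1 / real m \<Longrightarrow>
      count_series F s m * (1 - fps_X ^ m) ^ (?d + 1) = count_series p s m"
    using count_series_lattice_polytope[OF W aff] unfolding F_def by blast
  \<comment> \<open>The \<open>l\<close>-th dilate of \<open>P\<close> is the \<open>l * \<rho>\<close>-th dilate of the lattice polytope \<open>m/r P\<close>.\<close>
  define \<rho> :: rat where "\<rho> = of_nat r / of_nat m"
  have \<rho>: "\<rho> > 0" "1 / \<rho> = of_nat m / of_nat r" using r m by (auto simp: \<rho>_def)
  have ehr: "ehr P l = F (real_of_rat (l * \<rho>))" for l
  proof -
    have "real_of_rat (l * \<rho>) * (real m / real r) = real_of_rat l"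
      using r m by (simp add: \<rho>_def of_rat_mult of_rat_divide)
    then show ?thesis unfolding F_def ehr_def hull[symmetric] dilate_dilate by simp
  qed

  have part1: "\<exists>h :: int poly. (\<forall>i. coeff h i \<ge> 0) \<and>
      ehrhart_series P r = fps_of_poly (map_poly of_int h) / (1 - fps_X ^ m) ^ (?d + 1)"
  proof -
    define h where "h = Poly (map (\<lambda>n. int (p (real n / real m))) [0..<m * (?d + 1)])"
    have coeff_h: "coeff h n = int (p (real n / real m))" for n
    proof (cases "n < m * (?d + 1)")
      case False
      then have "real (m * (?d + 1)) \<le> real n" by (simp only: of_nat_le_iff not_less)
      then have "real ?d + 1 \<le> real n / real m" using m by (simp add: field_simps)
      then show ?thesis using False p by (simp add: h_def nth_default_def)
    qed (auto simp: h_def nth_default_def simp del: mult_Suc_right)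
    have "ehrhart_series P r = count_series F 0 m"
    proof (rule fps_ext)
      fix n
      have "F (real n / real m) = ehr P (of_nat n / of_nat r)"
        unfolding ehr using r by (simp add: \<rho>_def of_rat_divide)
      then show "fps_nth (ehrhart_series P r) n = fps_nth (count_series F 0 m) n"
        using ehr_0[OF P] by (auto simp: ehrhart_series_def count_series_def)
    qed
    moreover have "fps_of_poly (map_poly of_int h) = count_series p 0 m"
      by (rule fps_ext) (simp add: coeff_map_poly coeff_h count_series_def)
    moreover have "((1 - fps_X ^ m) ^ (?d + 1) :: rat fps) \<noteq> 0"
    proof -
      have "fps_nth (1 - fps_X ^ m :: rat fps) 0 = 1" using m by simp
      then have "(1 - fps_X ^ m :: rat fps) \<noteq> 0" by (metis fps_zero_nth zero_neq_one)
      then show ?thesis by simp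
    qed
    ultimately have "ehrhart_series P r = fps_of_poly (map_poly of_int h) / (1 - fps_X ^ m) ^ (?d + 1)"
      using series[OF m, of 0] m by (metis divide_pos_pos nonzero_mult_div_cancel_right of_nat_0_less_iff order_refl zero_less_one)
    then show ?thesis using coeff_h by (intro exI[of _ h]) auto
  qed

  obtain c0 where c0: "quasipolynomial_coeffs ?d c0 (\<lambda>l. of_nat (ehr P l))"
    and per0: "\<And>i. is_period (of_nat m / of_nat r) (c0 i)"
    by (rule quasipolynomial_of_series[where f="ehr P" and F=F and p=p, OF \<rho>(1) ehr])
      (use series[of 1] p \<rho>(2) in auto)

  have "\<exists>j. j dvd m \<and> least_common_period ?d c (of_nat j / of_nat r)"
    if c: "quasipolynomial_coeffs ?d c (\<lambda>l. of_nat (ehr P l))" for c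
  proof (rule exists_least_common_period[OF r m])
    show per: "is_period (of_nat m / of_nat r) (c i)" if "i \<le> ?d" for i
      using per0[of i] quasipolynomial_coeffs_unique[OF c c0 that] by (simp add: is_period_def)
    \<comment> \<open>The counting function is not constant: a polytope of positive dimension has at least two vertices.\<close>
    have two: "ehr P (of_nat m / of_nat r) \<ge> 2"
    proof -
      have "card W \<ge> 2"
      proof (rule ccontr)
        assume "\<not> card W \<ge> 2"
        then have "aff_dim W \<le> 0" using aff_dim_le_card[OF W(1)] by simp
        then show False using dimW by simp
      qed
      moreover have "ehr P (of_nat m / of_nat r) = card (convex hull W \<inter> integer_points)"
        by (simp add: ehr_def of_rat_divide hull)
      moreover have "card W \<le> card (convex hull W \<inter> integer_points)"
        using W hull_subset[of W convex]
        by (intro card_mono finite_integer_points_bounded bounded_convex_hull finite_imp_bounded) auto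
      ultimately show ?thesis by linarith
    qed
    fix q assume q: "\<And>i. i \<le> ?d \<Longrightarrow> is_period q (c i)"
    show "q * of_nat r \<in> \<int>"
    proof (rule common_period_multiple[OF c r per _ _ _ q])
      show "(of_nat (ehr P l) :: rat) = of_nat (ehr P l')"
        if "of_nat n < l * of_nat r" "l * of_nat r < of_nat n + 1"
          "of_nat n < l' * of_nat r" "l' * of_nat r < of_nat n + 1" for n l l'
        using ehr_constant_between[OF assms(3) that] by simp
      show "(0 :: rat) \<le> of_nat m / of_nat r" by simp
      show "(of_nat (ehr P (of_nat m / of_nat r)) :: rat) \<noteq> of_nat (ehr P 0)"
        using two ehr_0[OF P] by simp
    qed
  qed
  then show ?thesis using part1 c0 by (auto simp: quasipolynomial_def)
qed

end
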